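(* Let $\mathscr{X}=(\mathcal{X},d,\mu)$ be a compact homogeneous space. For any $p\geq1$, any $\varphi\in\mathscr{C}(\mathbb{R}^{\binom p2})$, any $n\geq1$ and any $r\geq2$, $$|\kappa^{(r)}(S_n(\varphi,\mathscr{X}))|\leq (Ap^2)^r\,(2r)^{r-1}\,n^{(p-1)r},\qquad A=\|\varphi\|_\infty .$$
   Context: A metric measure space (mm-space) $\mathscr{X}=(\mathcal{X},d,\mu)$ is a complete separable metric space with a Borel probability measure $\mu$, with $\mathcal{X}=\mathrm{supp}(\mu)$. It is a compact homogeneous space if, up to a measure-preserving isometry, it equals $(G/K,d_{G/K},\mu_{G/K})$ with $G$ a compact topological group, $K$ a closed subgroup, $d_{G/K}$ a $G$-invariant distance and $\mu_{G/K}$ the push-forward of the Haar probability measure of $G$; equivalently, the group of measure-preserving isometries of $\mathcal{X}$ acts transitively on $\mathcal{X}$. $\mathscr{C}$ denotes continuous real functions and $\|\cdot\|_\infty$ the supremum norm (the bound is vacuous if it is infinite). Let $(X_i)_{i\geq1}$ be i.i.d. with law $\mu$ and $S_n(\varphi,\mathscr{X})=\sum_{(i_1,\dots,i_p)\in\{1,\dots,n\}^p}\varphi\big((d(X_{i_a},X_{i_b}))_{1\leq a<b\leq p}\big)$. The $r$-th cumulant of a random variable $Z$ is $\kappa^{(r)}(Z)=r!\,[t^r]\log\mathbb{E}[e^{tZ}]$. *)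

theory Defs
  imports "HOL-Probability.Probability" "HOL-Algebra.Left_Coset"
begin

section \<open>Metric measure spaces\<close>

definition borel_of_topology :: "'a topology \<Rightarrow> 'a measure" where
  "borel_of_topology T = sigma (topspace T) {U. openin T U}"

definition measure_support :: "'a topology \<Rightarrow> 'a measure \<Rightarrow> 'a set" where
  "measure_support T \<mu> = {x \<in> topspace T. \<forall>U. openin T U \<and> x \<in> U \<longrightarrow> 0 < emeasure \<mu> U}"

locale mm_space = Metric_space M d
  for M :: "'a set" and d :: "'a \<Rightarrow> 'a \<Rightarrow> real" +
  fixes \<mu> :: "'a measure"
  assumes complete: "mcomplete"
    and separable: "separable_space mtopology"
    and prob: "prob_space \<mu>"
    and sets_eq_borel: "sets \<mu> = sets (borel_of_topology mtopology)"
    and full_support: "measure_support mtopology \<mu> = M"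

definition mm_isomorphism ::
    "'a set \<Rightarrow> ('a \<Rightarrow> 'a \<Rightarrow> real) \<Rightarrow> 'a measure \<Rightarrow>
     'b set \<Rightarrow> ('b \<Rightarrow> 'b \<Rightarrow> real) \<Rightarrow> 'b measure \<Rightarrow> ('a \<Rightarrow> 'b) \<Rightarrow> bool" where
  "mm_isomorphism M d \<mu> M' d' \<mu>' f \<longleftrightarrow>
     bij_betw f M M' \<and>
     (\<forall>x\<in>M. \<forall>y\<in>M. d' (f x) (f y) = d x y) \<and>
     f \<in> measurable \<mu> \<mu>' \<and> distr \<mu> \<mu>' f = \<mu>'"


section \<open>Compact homogeneous spaces\<close>

locale compact_topological_group = group G
  for G (structure) and T :: "'g topology" +
  assumes topspace_eq: "topspace T = carrier G"
    and continuous_mult: "continuous_map (prod_topology T T) T (\<lambda>(x, y). x \<otimes> y)"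
    and continuous_inv: "continuous_map T T (\<lambda>x. inv x)"
    and compact: "compact_space T"
    and hausdorff: "Hausdorff_space T"

text \<open>Regularity is automatic when the topology is metrizable; in general it is part of the
  definition of Haar measure, and without it uniqueness fails.\<close>

definition haar_probability :: "('g, 'm) monoid_scheme \<Rightarrow> 'g topology \<Rightarrow> 'g measure \<Rightarrow> bool" where
  "haar_probability G T \<nu> \<longleftrightarrow>
     prob_space \<nu> \<and> sets \<nu> = sets (borel_of_topology T) \<and>
     (\<forall>g\<in>carrier G. \<forall>B\<in>sets \<nu>. emeasure \<nu> (g <#\<^bsub>G\<^esub> B) = emeasure \<nu> B) \<and>
     (\<forall>B\<in>sets \<nu>. emeasure \<nu> B = (INF U\<in>{U. openin T U \<and> B \<subseteq> U}. emeasure \<nu> U)) \<and>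
     (\<forall>U. openin T U \<longrightarrow>
        emeasure \<nu> U = (SUP C\<in>{C. compactin T C \<and> C \<subseteq> U}. emeasure \<nu> C))"

text \<open>A distance on the set of left cosets \<open>gK\<close> that metrizes the quotient topology and is
  invariant under the left action \<open>h \<cdot> gK = hgK\<close>.\<close>

definition invariant_quotient_distance ::
    "('g, 'm) monoid_scheme \<Rightarrow> 'g topology \<Rightarrow> 'g set \<Rightarrow> ('g set \<Rightarrow> 'g set \<Rightarrow> real) \<Rightarrow> bool" where
  "invariant_quotient_distance G T K dGK \<longleftrightarrow>
     Metric_space (lcosets\<^bsub>G\<^esub> K) dGK \<and>
     quotient_map T (Metric_space.mtopology (lcosets\<^bsub>G\<^esub> K) dGK) (\<lambda>g. g <#\<^bsub>G\<^esub> K) \<and>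
     (\<forall>h\<in>carrier G. \<forall>C\<in>lcosets\<^bsub>G\<^esub> K. \<forall>D\<in>lcosets\<^bsub>G\<^esub> K.
        dGK (h <#\<^bsub>G\<^esub> C) (h <#\<^bsub>G\<^esub> D) = dGK C D)"

definition quotient_measure ::
    "('g, 'm) monoid_scheme \<Rightarrow> 'g set \<Rightarrow> ('g set \<Rightarrow> 'g set \<Rightarrow> real) \<Rightarrow> 'g measure \<Rightarrow> 'g set measure" where
  "quotient_measure G K dGK \<nu> =
     distr \<nu> (borel_of_topology (Metric_space.mtopology (lcosets\<^bsub>G\<^esub> K) dGK)) (\<lambda>g. g <#\<^bsub>G\<^esub> K)"

text \<open>HOL cannot quantify existentially over the type of the elements of the group, so that type
  is a parameter.  It occurs only in this hypothesis, hence a theorem that is polymorphic in it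
  covers groups with elements of any type.\<close>

definition compact_homogeneous_space ::
    "'g itself \<Rightarrow> 'a set \<Rightarrow> ('a \<Rightarrow> 'a \<Rightarrow> real) \<Rightarrow> 'a measure \<Rightarrow> bool" where
  "compact_homogeneous_space (ty :: 'g itself) M d \<mu> \<longleftrightarrow>
     mm_space M d \<mu> \<and>
     (\<exists>(G :: 'g monoid) T K dGK \<nu> f.
        compact_topological_group G T \<and>
        subgroup K G \<and> closedin T K \<and>
        haar_probability G T \<nu> \<and>
        invariant_quotient_distance G T K dGK \<and>
        mm_isomorphism M d \<mu> (lcosets\<^bsub>G\<^esub> K) dGK (quotient_measure G K dGK \<nu>) f)"


section \<open>Functions of the matrix of distances\<close>

definition index_pairs :: "nat \<Rightarrow> (nat \<times> nat) set" where
  "index_pairs p = {(a, b). 1 \<le> a \<and> a < b \<and> b \<le> p}"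

text \<open>The Euclidean space of dimension \<open>p choose 2\<close> is the product of copies of \<open>\<real>\<close> indexed by
  \<open>index_pairs p\<close>, i.e. the set of extensional functions on \<open>index_pairs p\<close>; it is a single point
  if \<open>p = 1\<close>.\<close>

abbreviation distance_matrix_space :: "nat \<Rightarrow> (nat \<times> nat \<Rightarrow> real) topology" where
  "distance_matrix_space p \<equiv> product_topology (\<lambda>_. euclideanreal) (index_pairs p)"

definition sup_norm_on :: "'a set \<Rightarrow> ('a \<Rightarrow> real) \<Rightarrow> ennreal" where
  "sup_norm_on D f = (SUP x\<in>D. ennreal \<bar>f x\<bar>)"

definition distance_sum ::
    "nat \<Rightarrow> ((nat \<times> nat \<Rightarrow> real) \<Rightarrow> real) \<Rightarrow> ('a \<Rightarrow> 'a \<Rightarrow> real) \<Rightarrow> nat \<Rightarrow> (nat \<Rightarrow> 'a) \<Rightarrow> real" where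
  "distance_sum p \<phi> d n x =
     (\<Sum>i \<in> {1..p} \<rightarrow>\<^sub>E {1..n}.
        \<phi> (restrict (\<lambda>(a, b). d (x (i a)) (x (i b))) (index_pairs p)))"


section \<open>Cumulants\<close>

text \<open>Power series expansions at \<open>0\<close> of real functions are unique.\<close>

lemma real_has_fps_expansion_unique:
  fixes f :: "real \<Rightarrow> real"
  assumes F: "f has_fps_expansion F" and G: "f has_fps_expansion G"
  shows "F = G"
proof (rule ccontr)
  assume "F \<noteq> G"
  define H where "H = F - G"
  define n where "n = subdegree H"
  define S where "S = fps_shift n H"
  have "H \<noteq> 0" using \<open>F \<noteq> G\<close> by (simp add: H_def)
  then have S0: "fps_nth S 0 \<noteq> 0" by (simp add: S_def n_def)
  have H: "(\<lambda>_. 0) has_fps_expansion H"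
    using has_fps_expansion_diff[OF F G] by (simp add: H_def)
  then have rad: "fps_conv_radius H > 0" and ev: "eventually (\<lambda>z. eval_fps H z = 0) (nhds 0)"
    by (auto simp: has_fps_expansion_def)
  have "eventually (\<lambda>z. z \<in> eball 0 (fps_conv_radius H)) (nhds (0::real))"
    using rad by (intro eventually_nhds_in_open) (auto simp: zero_ereal_def)
  then have "eventually (\<lambda>z. norm z < fps_conv_radius H) (nhds (0::real))"
    by eventually_elim (simp add: in_eball_iff dist_norm)
  with ev have "eventually (\<lambda>z. z \<noteq> 0 \<longrightarrow> eval_fps S z = 0) (nhds 0)"
    by eventually_elim (auto simp: S_def n_def eval_fps_shift)
  then have "eventually (\<lambda>z. eval_fps S z = 0) (at 0)"
    by (simp add: eventually_at_filter)
  then have lim0: "(eval_fps S \<longlongrightarrow> 0) (at 0)"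
    by (rule tendsto_eventually)
  have "fps_conv_radius S > 0" using rad by (simp add: S_def)
  then have "eval_fps S has_fps_expansion S" by (rule eval_fps_has_fps_expansion)
  then have "isCont (eval_fps S) 0" using has_fps_expansion_imp_continuous[of "eval_fps S" S UNIV] by simp
  then have "(eval_fps S \<longlongrightarrow> fps_nth S 0) (at 0)" by (simp add: isCont_def eval_fps_at_0)
  with lim0 have "fps_nth S 0 = 0" using LIM_unique by blast
  with S0 show False by simp
qed

definition cumulant :: "'w measure \<Rightarrow> ('w \<Rightarrow> real) \<Rightarrow> nat \<Rightarrow> real" where
  "cumulant P Z r =
     fact r * fps_nth (THE F. (\<lambda>t. ln (\<integral>\<omega>. exp (t * Z \<omega>) \<partial>P)) has_fps_expansion F) r"

end

theory Submission
  imports Defs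
begin

text \<open>
  By multilinearity the cumulant of \<open>S\<^sub>n\<close> is the sum over \<open>r\<close>-tuples of index tuples of the
  joint cumulants of the corresponding variables \<open>\<phi>(\<dots>)\<close>. Two index tuples are adjacent if they
  share an index. Merging two adjacent variables \<open>R\<close> and \<open>w\<close> into their product changes a joint
  cumulant by a sum of products of two smaller cumulants, one containing \<open>R\<close> and one containing
  \<open>w\<close>. Spanning forests satisfy the analogous recursion, so induction bounds a joint cumulant by
  \<open>A\<^sup>r 2\<^sup>r\<^sup>-\<^sup>1\<close> times the number of spanning trees of the adjacency graph.

  Homogeneity gains a factor \<open>n\<close>: if two families of index tuples share at most one index, the
  corresponding products are still uncorrelated, because conditioning on the value of the shared
  point does not change the law of a function of the distances. Hence a joint cumulant vanishes
  unless every index tuple shares at least two indices with the others. Peeling spanning trees from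
  their leaves, as in the count of rooted forests that proves Cayley's formula, and using this
  condition for one leaf, gives \<open>r\<^sup>r\<^sup>-\<^sup>2 n\<^sup>p (p\<^sup>2 n\<^sup>p\<^sup>-\<^sup>1)\<^sup>r\<^sup>-\<^sup>2 \<sqdot> r p\<^sup>4 n\<^sup>p\<^sup>-\<^sup>2\<close>, which is the bound.
\<close>

section \<open>Joint cumulants of set functions and spanning forests\<close>

text \<open>Read a set function as a square-free polynomial: its value at B is the coefficient of
  the monomial over B, and squares of variables are 0. Then \<open>subset_conv\<close> is
  multiplication, and inserting R into the argument is, on sets disjoint from R, differentiation in
  the variables of R. With M the generating function of the joint moments,
  \<open>set_cumulant m R\<close> is (D_R M)/M, for a single variable the derivative of log M, and
  merging is the quotient rule. Bounding the expansion over set partitions termwise would lose the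
  cancellations behind vanishing cumulants.

  The obstacle is that the two-index condition is no relation between pairs: a tuple may share one
  index with each of two others, and the joint cumulant is then not forced to vanish. The condition
  compares a tuple with the union of all others, so it cannot serve as the adjacency of the trees,
  and in the count it applies only where one value varies while all others are fixed. A leaf allows
  this, since a single edge depends on its value. Plain adjacency gives n^p (n^(p-1))^(r-1), one
  factor n too many, so one leaf suffices.\<close>

definition subset_conv :: "('v set \<Rightarrow> real) \<Rightarrow> ('v set \<Rightarrow> real) \<Rightarrow> 'v set \<Rightarrow> real" where
  "subset_conv f g W = (\<Sum>B\<in>Pow W. f B * g (W - B))"

text \<open>Both sides run over the ordered splittings of W into three parts. The summand is
  arbitrary because the identity also serves for forests.\<close>

lemma sum_Pow_assoc:
  assumes "finite W"
  shows "(\<Sum>B\<in>Pow W. \<Sum>A\<in>Pow B. F A (B - A) (W - B)) =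
         (\<Sum>A\<in>Pow W. \<Sum>C\<in>Pow (W - A). F A C (W - A - C))"
proof -
  have fin: "finite B" if "B \<in> Pow W" for B using that assms by (auto intro: finite_subset)
  have "(\<Sum>B\<in>Pow W. \<Sum>A\<in>Pow B. F A (B - A) (W - B)) =
        (\<Sum>(B, A)\<in>(SIGMA B:Pow W. Pow B). F A (B - A) (W - B))"
    using fin assms by (subst sum.Sigma) auto
  also have "\<dots> = (\<Sum>(A, C)\<in>(SIGMA A:Pow W. Pow (W - A)). F A C (W - A - C))"
    by (rule sum.reindex_bij_witness[where i = "\<lambda>(A, C). (A \<union> C, A)" and j = "\<lambda>(B, A). (A, B - A)"])
       (auto intro!: arg_cong2[where f = "F _"])
  also have "\<dots> = (\<Sum>A\<in>Pow W. \<Sum>C\<in>Pow (W - A). F A C (W - A - C))"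
    using fin assms by (subst sum.Sigma) auto
  finally show ?thesis .
qed

lemma sum_Pow_insert:
  assumes "finite W" "w \<notin> W"
  shows "(\<Sum>B\<in>Pow (insert w W). F B) = (\<Sum>B\<in>Pow W. F B) + (\<Sum>B\<in>Pow W. F (insert w B))"
proof -
  have "inj_on (insert w) (Pow W)"
    using assms by (auto simp: inj_on_def)
  then show ?thesis
    using assms unfolding Pow_insert
    by (subst sum.union_disjoint) (auto simp: sum.reindex)
qed

lemma subset_conv_cong:
  assumes "\<And>B. B \<subseteq> W \<Longrightarrow> f B = f' B" "\<And>B. B \<subseteq> W \<Longrightarrow> g B = g' B"
  shows "subset_conv f g W = subset_conv f' g' W"
  unfolding subset_conv_def using assms by (intro sum.cong) auto

lemma subset_conv_commute:
  assumes "finite W"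
  shows "subset_conv f g W = subset_conv g f W"
  unfolding subset_conv_def
  by (rule sum.reindex_bij_witness[where i = "\<lambda>B. W - B" and j = "\<lambda>B. W - B"])
     (auto simp: double_diff)

lemma subset_conv_assoc:
  assumes "finite W"
  shows "subset_conv (subset_conv f g) h W = subset_conv f (subset_conv g h) W"
  using sum_Pow_assoc[OF assms, of "\<lambda>A B C. f A * g B * h C"]
  by (simp add: subset_conv_def sum_distrib_left sum_distrib_right mult.assoc)

lemma subset_conv_delta:
  assumes "finite W" "\<And>B. B \<subseteq> W \<Longrightarrow> B \<noteq> {} \<Longrightarrow> g B = 0"
  shows "subset_conv f g W = f W * g {}"
proof -
  have "subset_conv f g W = (\<Sum>B\<in>Pow W. if B = W then f W * g {} else 0)"
    unfolding subset_conv_def using assms(2) by (intro sum.cong) auto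
  also have "\<dots> = f W * g {}" using assms(1) by simp
  finally show ?thesis .
qed

text \<open>Leibniz rule: \<open>w\<close> falls into exactly one of the two factors.\<close>

lemma subset_conv_insert:
  assumes "finite W" "w \<notin> W"
  shows "subset_conv f g (insert w W) =
    subset_conv (\<lambda>B. f (insert w B)) g W + subset_conv f (\<lambda>B. g (insert w B)) W"
proof -
  have 1: "(\<Sum>B\<in>Pow W. f B * g (insert w W - B)) = (\<Sum>B\<in>Pow W. f B * g (insert w (W - B)))"
    using assms by (intro sum.cong arg_cong2[where f = "(*)"] arg_cong[where f = g]) auto
  have 2: "(\<Sum>B\<in>Pow W. f (insert w B) * g (insert w W - insert w B)) =
      (\<Sum>B\<in>Pow W. f (insert w B) * g (W - B))"
    using assms by (intro sum.cong arg_cong2[where f = "(*)"] arg_cong[where f = g]) auto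
  show ?thesis
    unfolding subset_conv_def sum_Pow_insert[OF assms] 1 2 by simp
qed

text \<open>The equation that makes this the inverse of m for \<open>subset_conv\<close>, solved for
  the term with B empty when m {} = 1. Infinite sets get a default value, since the recursion
  descends on the cardinality.\<close>

function set_inverse :: "('v set \<Rightarrow> real) \<Rightarrow> 'v set \<Rightarrow> real" where
  "set_inverse m C =
    (if C = {} then 1 else if infinite C then 0
     else - (\<Sum>B\<in>Pow C - {{}}. m B * set_inverse m (C - B)))"
  by auto
termination
  by (relation "Wellfounded.measure (\<lambda>(m, C). card C)") (auto intro!: psubset_card_mono)

declare set_inverse.simps [simp del]

lemma set_inverse_empty [simp]: "set_inverse m {} = 1"
  by (simp add: set_inverse.simps)

lemma subset_conv_set_inverse:
  assumes "finite W" "m {} = 1"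
  shows "subset_conv m (set_inverse m) W = of_bool (W = {})"
proof (cases "W = {}")
  case True
  then show ?thesis using assms by (simp add: subset_conv_def)
next
  case False
  have "subset_conv m (set_inverse m) W =
      m {} * set_inverse m (W - {}) + (\<Sum>B\<in>Pow W - {{}}. m B * set_inverse m (W - B))"
    unfolding subset_conv_def using assms(1) by (intro sum.remove) auto
  also have "\<dots> = 0"
    using False assms by (simp add: set_inverse.simps[of m W])
  finally show ?thesis using False by simp
qed

lemma set_inverse_cong:
  assumes "finite C" "\<And>B. B \<subseteq> C \<Longrightarrow> m B = m' B"
  shows "set_inverse m C = set_inverse m' C"
  using assms
proof (induction "card C" arbitrary: C rule: less_induct)
  case less
  have "set_inverse m (C - B) = set_inverse m' (C - B)" if "B \<in> Pow C - {{}}" for B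
    using that less.prems by (intro less.hyps) (auto intro!: psubset_card_mono)
  then have "(\<Sum>B\<in>Pow C - {{}}. m B * set_inverse m (C - B)) =
      (\<Sum>B\<in>Pow C - {{}}. m' B * set_inverse m' (C - B))"
    using less.prems by (intro sum.cong arg_cong2[where f = "(*)"]) auto
  then show ?case
    using less.prems by (simp add: set_inverse.simps[of _ C])
qed

text \<open>If \<open>m B\<close> is the expectation of the product of random variables indexed by \<open>B\<close>, then
  \<open>set_cumulant m R W\<close> is the joint cumulant of the product over \<open>R\<close>, taken as one variable,
  and of the variables indexed by \<open>W\<close>.\<close>

definition set_cumulant :: "('v set \<Rightarrow> real) \<Rightarrow> 'v set \<Rightarrow> 'v set \<Rightarrow> real" where
  "set_cumulant m R = subset_conv (\<lambda>B. m (R \<union> B)) (set_inverse m)"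

lemma set_cumulant_empty [simp]: "set_cumulant m R {} = m R"
  by (simp add: set_cumulant_def subset_conv_def)

text \<open>The derivative of 1/m is -(1/m)(m'/m). Differentiating m (1/m) = 1 in \<open>w\<close>
  gives \<open>D\<close>; multiplying by 1/m isolates the derivative.\<close>

lemma set_inverse_insert:
  assumes "finite W" "w \<notin> W" "m {} = 1"
  shows "set_inverse m (insert w W) = - subset_conv (set_inverse m) (set_cumulant m {w}) W"
proof -
  let ?D = "\<lambda>B. set_inverse m (insert w B)"
  have D: "subset_conv m ?D B = - set_cumulant m {w} B" if "B \<subseteq> W" for B
  proof -
    have "finite B" "w \<notin> B" using that assms by (auto intro: finite_subset)
    then have "0 = subset_conv (\<lambda>B. m (insert w B)) (set_inverse m) B + subset_conv m ?D B"
      using subset_conv_set_inverse[of "insert w B" m] assms(3) subset_conv_insert[of B w m "set_inverse m"]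
      by simp
    then show ?thesis by (simp add: set_cumulant_def)
  qed
  have "?D W = subset_conv ?D (subset_conv m (set_inverse m)) W"
    using assms by (subst subset_conv_delta)
      (auto simp: subset_conv_set_inverse finite_subset[of _ W])
  also have "\<dots> = subset_conv ?D (subset_conv (set_inverse m) m) W"
    using assms(1) by (intro subset_conv_cong subset_conv_commute) (auto intro: finite_subset)
  also have "\<dots> = subset_conv (subset_conv (set_inverse m) m) ?D W"
    using assms(1) by (rule subset_conv_commute)
  also have "\<dots> = subset_conv (set_inverse m) (subset_conv m ?D) W"
    using assms(1) by (rule subset_conv_assoc)
  also have "\<dots> = subset_conv (set_inverse m) (\<lambda>B. - set_cumulant m {w} B) W"
    using D by (intro subset_conv_cong) auto
  also have "\<dots> = - subset_conv (set_inverse m) (set_cumulant m {w}) W"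
    by (simp add: subset_conv_def sum_negf)
  finally show ?thesis .
qed

text \<open>Quotient rule for (D_R m)/m in the variable \<open>w\<close>. The first term merges
  \<open>w\<close> into the block R; the second distributes the remaining variables over a cumulant
  containing R and one containing \<open>w\<close>.\<close>

lemma set_cumulant_insert:
  assumes "finite W" "w \<notin> W" "m {} = 1"
  shows "set_cumulant m R (insert w W) =
    set_cumulant m (insert w R) W - subset_conv (set_cumulant m R) (set_cumulant m {w}) W"
proof -
  have "set_cumulant m R (insert w W) = subset_conv (\<lambda>B. m (R \<union> insert w B)) (set_inverse m) W
      + subset_conv (\<lambda>B. m (R \<union> B)) (\<lambda>B. set_inverse m (insert w B)) W"
    unfolding set_cumulant_def using assms by (intro subset_conv_insert)
  also have "subset_conv (\<lambda>B. m (R \<union> insert w B)) (set_inverse m) W = set_cumulant m (insert w R) W"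
    by (simp add: set_cumulant_def)
  also have "subset_conv (\<lambda>B. m (R \<union> B)) (\<lambda>B. set_inverse m (insert w B)) W =
      subset_conv (\<lambda>B. m (R \<union> B)) (\<lambda>B. - subset_conv (set_inverse m) (set_cumulant m {w}) B) W"
    using assms by (intro subset_conv_cong set_inverse_insert) (auto intro: finite_subset)
  also have "\<dots> = - subset_conv (\<lambda>B. m (R \<union> B)) (subset_conv (set_inverse m) (set_cumulant m {w})) W"
    by (simp add: subset_conv_def sum_negf)
  also have "\<dots> = - subset_conv (set_cumulant m R) (set_cumulant m {w}) W"
    unfolding set_cumulant_def by (simp add: subset_conv_assoc[OF assms(1)])
  finally show ?thesis by simp
qed

text \<open>The numerator is the constant m R times m, so the quotient is constant and has no
  coefficient at a nonempty set.\<close>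

lemma set_cumulant_eq_0:
  assumes "finite W" "W \<noteq> {}" "m {} = 1"
    and mult: "\<And>B. B \<subseteq> W \<Longrightarrow> m (R \<union> B) = m R * m B"
  shows "set_cumulant m R W = 0"
proof -
  have "set_cumulant m R W = subset_conv (\<lambda>B. m R * m B) (set_inverse m) W"
    unfolding set_cumulant_def using mult by (intro subset_conv_cong) auto
  also have "\<dots> = m R * subset_conv m (set_inverse m) W"
    by (simp add: subset_conv_def sum_distrib_left mult.assoc)
  finally show ?thesis using assms by (simp add: subset_conv_set_inverse)
qed

text \<open>Here the factorizing variable is an argument \<open>w\<close> and not the root block R.
  The two terms of \<open>set_cumulant_insert\<close> both equal m {w} times the cumulant of R and W
  - {w}, since \<open>set_cumulant m {w}\<close> is concentrated at the empty set; they
  cancel.\<close>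

lemma set_cumulant_eq_0':
  assumes "finite W" "w \<in> W" "m {} = 1"
    and mult: "\<And>B. B \<subseteq> R \<union> W - {w} \<Longrightarrow> m (insert w B) = m {w} * m B"
    and "w \<notin> R"
  shows "set_cumulant m R W = 0"
proof -
  define V where "V = W - {w}"
  have V: "finite V" "w \<notin> V" "W = insert w V" using assms by (auto simp: V_def)
  have mV: "m (insert w B) = m {w} * m B" if "B \<subseteq> R \<union> V" for B
    using that assms(5) by (intro mult) (auto simp: V_def)
  have "set_cumulant m (insert w R) V = subset_conv (\<lambda>B. m {w} * m (R \<union> B)) (set_inverse m) V"
    unfolding set_cumulant_def using mV by (intro subset_conv_cong) (simp_all only: insert_is_Un[symmetric] Un_insert_left Un_mono subset_refl)
  also have "\<dots> = m {w} * set_cumulant m R V"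
    by (simp add: set_cumulant_def subset_conv_def sum_distrib_left mult.assoc)
  finally have 1: "set_cumulant m (insert w R) V = m {w} * set_cumulant m R V" .
  have "set_cumulant m {w} B = 0" if "B \<subseteq> V" "B \<noteq> {}" for B
  proof (intro set_cumulant_eq_0)
    show "finite B" using that(1) V(1) by (rule finite_subset)
    show "m ({w} \<union> C) = m {w} * m C" if "C \<subseteq> B" for C
      using mV[of C] that \<open>B \<subseteq> V\<close> by (metis insert_is_Un le_supI2 order_trans)
  qed (use that assms(3) in auto)
  then have 2: "subset_conv (set_cumulant m R) (set_cumulant m {w}) V = set_cumulant m R V * m {w}"
    using V by (subst subset_conv_delta) auto
  show ?thesis
    using set_cumulant_insert[of V w m R] V assms(3) 1 2 by simp
qed

text \<open>For finite disjoint R and W this counts the spanning forests of R \<union> W with root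
  set R, edges pointing from a child j to its parent b. J is the set of children of the roots, and
  these act as the roots of the rest. J = {} is left out to make the recursion terminate.\<close>

function forest_weight :: "('v \<Rightarrow> 'v \<Rightarrow> bool) \<Rightarrow> 'v set \<Rightarrow> 'v set \<Rightarrow> real" where
  "forest_weight adj R W =
    (if W = {} then 1 else if infinite W then 0
     else \<Sum>J\<in>Pow W - {{}}. (\<Prod>j\<in>J. \<Sum>b\<in>R. of_bool (adj j b)) * forest_weight adj J (W - J))"
  by auto
termination
  by (relation "Wellfounded.measure (\<lambda>(adj, R, W). card W)") (auto intro!: psubset_card_mono)

declare forest_weight.simps [simp del]

lemma forest_weight_empty [simp]: "forest_weight adj R {} = 1"
  by (simp add: forest_weight.simps)

lemma forest_weight_no_root:
  assumes "W \<noteq> {}"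
  shows "forest_weight adj {} W = 0"
proof -
  have "(\<Sum>J\<in>Pow W - {{}}. 0 ^ card J * forest_weight adj J (W - J)) = 0" if "finite W"
  proof (intro sum.neutral ballI)
    fix J assume "J \<in> Pow W - {{}}"
    then have "card J \<noteq> 0" using finite_subset[of J W] that by auto
    then show "0 ^ card J * forest_weight adj J (W - J) = 0" by simp
  qed
  then show ?thesis
    using assms by (simp add: forest_weight.simps[of adj "{}" W])
qed

lemma forest_weight_nonneg: "forest_weight adj R W \<ge> 0"
proof (induction adj R W rule: forest_weight.induct)
  case (1 adj R W)
  then have "0 \<le> (\<Sum>J\<in>Pow W - {{}}. (\<Prod>j\<in>J. \<Sum>b\<in>R. of_bool (adj j b)) * forest_weight adj J (W - J))"
    if "W \<noteq> {}" "finite W"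
    using that by (intro sum_nonneg mult_nonneg_nonneg prod_nonneg) auto
  then show ?case
    by (subst forest_weight.simps) simp
qed

text \<open>Readmitting J = {} makes the formula uniform: the term is 1 if W is empty, and otherwise
  0 because no root is left.\<close>

lemma forest_weight_eq:
  assumes "finite W"
  shows "forest_weight adj R W =
    (\<Sum>J\<in>Pow W. (\<Prod>j\<in>J. \<Sum>b\<in>R. of_bool (adj j b)) * forest_weight adj J (W - J))"
proof (cases "W = {}")
  case False
  have "(\<Sum>J\<in>Pow W. (\<Prod>j\<in>J. \<Sum>b\<in>R. of_bool (adj j b)) * forest_weight adj J (W - J)) =
     (\<Prod>j\<in>{}. \<Sum>b\<in>R. of_bool (adj j b)) * forest_weight adj {} (W - {})
     + (\<Sum>J\<in>Pow W - {{}}. (\<Prod>j\<in>J. \<Sum>b\<in>R. of_bool (adj j b)) * forest_weight adj J (W - J))"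
    using assms by (intro sum.remove) auto
  then show ?thesis
    using False assms by (simp add: forest_weight.simps[of adj R] forest_weight_no_root)
qed auto

text \<open>Every vertex hangs from exactly one root, so a forest splits into the trees over R1 and
  those over R2. The induction splits the first level in the same way.\<close>

lemma forest_weight_union:
  assumes "finite W" "finite R1" "finite R2" "R1 \<inter> R2 = {}"
  shows "forest_weight adj (R1 \<union> R2) W = subset_conv (forest_weight adj R1) (forest_weight adj R2) W"
  using assms
proof (induction "card W" arbitrary: W R1 R2 rule: less_induct)
  case less
  let ?f = "forest_weight adj"
  define P where "P = (\<lambda>R J. \<Prod>j\<in>J. \<Sum>b\<in>R. of_bool (adj j b) :: real)"
  have eq: "?f R V = (\<Sum>J\<in>Pow V. P R J * ?f J (V - J))" if "V \<subseteq> W" for R V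
    unfolding P_def using that less.prems by (intro forest_weight_eq) (auto intro: finite_subset)
  show ?case
  proof (cases "W = {}")
    case True
    then show ?thesis by (simp add: subset_conv_def)
  next
    case False
    have fin: "finite J" if "J \<subseteq> W" for J using that less.prems by (auto intro: finite_subset)
    have IH: "?f J (W - J) = (\<Sum>V\<in>Pow (W - J). ?f J1 V * ?f (J - J1) (W - J - V))"
      if J: "J \<subseteq> W" "J1 \<subseteq> J" for J J1
    proof (cases "J = {}")
      case True
      have "?f {} V * ?f {} (W - V) = 0" if "V \<subseteq> W" for V
        using \<open>W \<noteq> {}\<close> that forest_weight_no_root[of _ adj] by (cases "V = {}") auto
      then have "(\<Sum>V\<in>Pow W. ?f {} V * ?f {} (W - V)) = 0" by (intro sum.neutral) auto
      then show ?thesis using True J False forest_weight_no_root[of W adj] by simp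
    next
      case False
      have "?f (J1 \<union> (J - J1)) (W - J) = subset_conv (?f J1) (?f (J - J1)) (W - J)"
        using False J less.prems fin
        by (intro less.hyps) (auto intro!: psubset_card_mono intro: finite_subset)
      moreover have "J1 \<union> (J - J1) = J" using J by auto
      ultimately show ?thesis by (simp add: subset_conv_def)
    qed
    have P: "P (R1 \<union> R2) J = (\<Sum>J1\<in>Pow J. P R1 J1 * P R2 (J - J1))" if "J \<subseteq> W" for J
      using less.prems fin[OF that] unfolding P_def
      by (subst sum.union_disjoint) (auto simp: prod_add)
    have "?f (R1 \<union> R2) W = (\<Sum>J\<in>Pow W. \<Sum>J1\<in>Pow J. \<Sum>V\<in>Pow (W - J).
        P R1 J1 * P R2 (J - J1) * (?f J1 V * ?f (J - J1) (W - J - V)))"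
      unfolding eq[OF order_refl]
    proof (intro sum.cong refl)
      fix J assume J: "J \<in> Pow W"
      show "P (R1 \<union> R2) J * ?f J (W - J) = (\<Sum>J1\<in>Pow J. \<Sum>V\<in>Pow (W - J).
        P R1 J1 * P R2 (J - J1) * (?f J1 V * ?f (J - J1) (W - J - V)))"
        using J by (auto simp: P sum_distrib_right sum_distrib_left[symmetric] IH intro!: sum.cong)
    qed
    also have "\<dots> = (\<Sum>(J, J1, V)\<in>(SIGMA J:Pow W. Pow J \<times> Pow (W - J)).
        P R1 J1 * P R2 (J - J1) * (?f J1 V * ?f (J - J1) (W - J - V)))"
      using less.prems fin by (simp add: sum.Sigma sum.cartesian_product split_def)
    \<comment> \<open>J1 and J - J1 are the children of R1 and of R2, and V holds the later
      descendants of J1. The new variable W1 = J1 \<union> V collects all that hangs from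
      R1.\<close>
    also have "\<dots> = (\<Sum>(W1, J1, J2)\<in>(SIGMA W1:Pow W. Pow W1 \<times> Pow (W - W1)).
        P R1 J1 * ?f J1 (W1 - J1) * (P R2 J2 * ?f J2 (W - W1 - J2)))"
      apply (rule sum.reindex_bij_witness[where j = "\<lambda>(J, J1, V). (J1 \<union> V, J1, J - J1)"
            and i = "\<lambda>(W1, J1, J2). (J1 \<union> J2, J1, W1 - J1)"])
          apply auto[4]
      subgoal for x
      proof -
        assume "x \<in> (SIGMA J:Pow W. Pow J \<times> Pow (W - J))"
        then obtain J J1 V where x: "x = (J, J1, V)" "J \<subseteq> W" "J1 \<subseteq> J" "V \<subseteq> W - J" by auto
        then have "J1 \<union> V - J1 = V" "W - (J1 \<union> V) - (J - J1) = W - J - V" by auto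
        then show ?thesis using x by simp
      qed
      done
    also have "\<dots> = (\<Sum>W1\<in>Pow W. (\<Sum>J1\<in>Pow W1. P R1 J1 * ?f J1 (W1 - J1)) *
        (\<Sum>J2\<in>Pow (W - W1). P R2 J2 * ?f J2 (W - W1 - J2)))"
      using less.prems fin by (simp add: sum_product sum.Sigma sum.cartesian_product split_def)
    also have "\<dots> = subset_conv (?f R1) (?f R2) W"
      unfolding subset_conv_def
      by (intro sum.cong arg_cong2[where f = "(*)"] eq[symmetric]) auto
    finally show ?thesis .
  qed
qed

text \<open>Attaching the root \<open>w\<close> to its neighbour b turns a forest with roots insert
  w R into one with roots R, injectively. In the recursion these are the terms with \<open>w\<close>
  in the first level.\<close>

lemma forest_weight_insert:
  assumes "finite W" "finite R" "w \<notin> W" "w \<notin> R" "b \<in> R" "adj w b"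
  shows "forest_weight adj (insert w R) W \<le> forest_weight adj R (insert w W)"
proof -
  let ?f = "forest_weight adj"
  define P where "P = (\<lambda>R J. \<Prod>j\<in>J. \<Sum>b\<in>R. of_bool (adj j b) :: real)"
  have fin: "finite J" if "J \<subseteq> W" for J using that assms by (auto intro: finite_subset)
  have eq: "?f R V = (\<Sum>J\<in>Pow V. P R J * ?f J (V - J))" if "finite V" for R V
    unfolding P_def using that by (rule forest_weight_eq)
  have P0: "P R J \<ge> 0" for J unfolding P_def by (auto intro!: prod_nonneg sum_nonneg)
  have c: "1 \<le> (\<Sum>b\<in>R. of_bool (adj w b) :: real)"
    using member_le_sum[of b R "\<lambda>b. of_bool (adj w b) :: real"] assms by auto
  have "?f (insert w R) W = subset_conv (?f R) (?f {w}) W"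
    using forest_weight_union[of W R "{w}"] assms by simp
  also have "\<dots> = (\<Sum>B\<in>Pow W. \<Sum>J\<in>Pow B. P R J * ?f J (B - J) * ?f {w} (W - B))"
    unfolding subset_conv_def sum_distrib_right[symmetric] using fin
    by (intro sum.cong arg_cong2[where f = "(*)"] eq) auto
  also have "\<dots> = (\<Sum>J\<in>Pow W. \<Sum>V\<in>Pow (W - J). P R J * ?f J V * ?f {w} (W - J - V))"
    using assms(1) by (rule sum_Pow_assoc)
  also have "\<dots> = (\<Sum>J\<in>Pow W. P R J * subset_conv (?f J) (?f {w}) (W - J))"
    by (simp add: subset_conv_def sum_distrib_left mult.assoc)
  also have "\<dots> = (\<Sum>J\<in>Pow W. P R J * ?f (insert w J) (W - J))"
  proof (intro sum.cong refl)
    fix J assume J: "J \<in> Pow W"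
    then have "w \<notin> J" "finite J" using assms fin by auto
    then show "P R J * subset_conv (?f J) (?f {w}) (W - J) = P R J * ?f (insert w J) (W - J)"
      using forest_weight_union[of "W - J" J "{w}" adj] assms by simp
  qed
  also have "\<dots> \<le> (\<Sum>J\<in>Pow W. P R (insert w J) * ?f (insert w J) (W - J))"
  proof (intro sum_mono mult_right_mono forest_weight_nonneg)
    fix J assume "J \<in> Pow W"
    then have "P R (insert w J) = (\<Sum>b\<in>R. of_bool (adj w b)) * P R J"
      unfolding P_def using fin assms by (subst prod.insert) auto
    then show "P R J \<le> P R (insert w J)"
      using mult_right_mono[OF c P0[of J]] by simp
  qed
  also have "\<dots> \<le> (\<Sum>J\<in>Pow W. P R J * ?f J (insert w W - J))
      + (\<Sum>J\<in>Pow W. P R (insert w J) * ?f (insert w J) (W - J))"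
    using P0 by (auto intro!: sum_nonneg mult_nonneg_nonneg forest_weight_nonneg)
  also have "\<dots> = (\<Sum>J\<in>Pow (insert w W). P R J * ?f J (insert w W - J))"
    unfolding sum_Pow_insert[OF assms(1,3)] using assms(3) by (auto intro!: sum.cong arg_cong2[where f = "(*)"] arg_cong[where f = "?f _"])
  also have "\<dots> = ?f R (insert w W)"
    using assms by (intro eq[symmetric]) auto
  finally show ?thesis .
qed

text \<open>If some w in W is adjacent to R, both terms of \<open>set_cumulant_insert\<close> are
  bounded by the same multiple of the number of forests rooted at insert w R, the product term by
  \<open>forest_weight_union\<close>. This costs one factor 2 per element of W. If there is no such
  w, then R factorizes from W and the cumulant vanishes.\<close>

lemma abs_set_cumulant_le:
  assumes "finite W" "finite R" "R \<inter> W = {}" "R \<union> W \<subseteq> V"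
    and m: "m {} = 1"
    and bound: "\<And>B. B \<subseteq> V \<Longrightarrow> finite B \<Longrightarrow> \<bar>m B\<bar> \<le> A ^ card B"
    and mult: "\<And>B C. B \<subseteq> V \<Longrightarrow> C \<subseteq> V \<Longrightarrow> finite B \<Longrightarrow> finite C \<Longrightarrow> B \<inter> C = {} \<Longrightarrow>
      (\<forall>b\<in>B. \<forall>c\<in>C. \<not> adj c b) \<Longrightarrow> m (B \<union> C) = m B * m C"
    and A: "A \<ge> 0"
  shows "\<bar>set_cumulant m R W\<bar> \<le> A ^ (card R + card W) * 2 ^ card W * forest_weight adj R W"
  using assms(1-4)
proof (induction "card W" arbitrary: R W rule: less_induct)
  case less
  let ?f = "forest_weight adj"
  show ?case
  proof (cases "\<exists>w\<in>W. \<exists>b\<in>R. adj w b")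
    case False
    have "set_cumulant m R W = 0" if "W \<noteq> {}"
      using that less.prems False
      by (intro set_cumulant_eq_0 mult m) (auto intro: finite_subset)
    then show ?thesis
      using bound[of R] less.prems A by (cases "W = {}") (auto intro!: mult_nonneg_nonneg forest_weight_nonneg)
  next
    case True
    then obtain w b where w: "w \<in> W" "b \<in> R" "adj w b" by auto
    define U where "U = W - {w}"
    have U: "W = insert w U" "w \<notin> U" "finite U" "card W = Suc (card U)"
      using w less.prems card_Suc_Diff1[of W w] by (auto simp: U_def)
    define c where "c = A ^ (card R + card W) * 2 ^ card U"
    have c0: "c \<ge> 0" using A by (simp add: c_def)
    have wR: "w \<notin> R" using w less.prems by auto
    have 1: "\<bar>set_cumulant m (insert w R) U\<bar> \<le> c * ?f (insert w R) U"
      using less.hyps[of U "insert w R"] less.prems U wR by (simp add: c_def)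
    have "\<bar>subset_conv (set_cumulant m R) (set_cumulant m {w}) U\<bar>
        \<le> (\<Sum>B\<in>Pow U. \<bar>set_cumulant m R B\<bar> * \<bar>set_cumulant m {w} (U - B)\<bar>)"
      unfolding subset_conv_def by (rule order_trans[OF sum_abs]) (simp add: abs_mult)
    also have "\<dots> \<le> (\<Sum>B\<in>Pow U. c * (?f R B * ?f {w} (U - B)))"
    proof (intro sum_mono)
      fix B assume B: "B \<in> Pow U"
      then have fin: "finite B" and card: "card B \<le> card U" and card': "card (U - B) = card U - card B"
        using U by (auto intro: finite_subset card_mono intro!: card_Diff_subset)
      have b1: "\<bar>set_cumulant m R B\<bar> \<le> A ^ (card R + card B) * 2 ^ card B * ?f R B"
        using B U less.prems fin card by (intro less.hyps) auto
      have b2: "\<bar>set_cumulant m {w} (U - B)\<bar> \<le> A ^ (card {w} + card (U - B)) * 2 ^ card (U - B) * ?f {w} (U - B)"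
        using B U less.prems fin card card' by (intro less.hyps) auto
      have "\<bar>set_cumulant m R B\<bar> * \<bar>set_cumulant m {w} (U - B)\<bar> \<le>
          (A ^ (card R + card B) * 2 ^ card B * ?f R B) *
          (A ^ (card {w} + card (U - B)) * 2 ^ card (U - B) * ?f {w} (U - B))"
        using A by (intro mult_mono b1 b2) (auto intro!: mult_nonneg_nonneg forest_weight_nonneg)
      also have "\<dots> = (A ^ (card R + card B) * A ^ (card {w} + card (U - B))) *
          (2 ^ card B * 2 ^ card (U - B)) * (?f R B * ?f {w} (U - B))"
        by (simp only: mult_ac)
      also have "\<dots> = c * (?f R B * ?f {w} (U - B))"
        using card card' U by (simp add: c_def power_add[symmetric])
      finally show "\<bar>set_cumulant m R B\<bar> * \<bar>set_cumulant m {w} (U - B)\<bar> \<le> c * (?f R B * ?f {w} (U - B))" .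
    qed
    also have "\<dots> = c * ?f (insert w R) U"
      using forest_weight_union[of U R "{w}" adj] U less.prems wR
      by (simp add: subset_conv_def sum_distrib_left)
    finally have 2: "\<bar>subset_conv (set_cumulant m R) (set_cumulant m {w}) U\<bar> \<le> c * ?f (insert w R) U" .
    have "\<bar>set_cumulant m R W\<bar> \<le> 2 * (c * ?f (insert w R) U)"
      using 1 2 set_cumulant_insert[of U w m R] U m by simp
    also have "\<dots> \<le> 2 * (c * ?f R W)"
      using forest_weight_insert[of U R w b adj] U less.prems w wR c0 by (simp add: mult_left_mono)
    also have "\<dots> = A ^ (card R + card W) * 2 ^ card W * ?f R W"
      using U by (simp add: c_def)
    finally show ?thesis .
  qed
qed

section \<open>Counting spanning forests\<close>

lemma sum_Pow_power_card:
  fixes x y :: real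
  assumes "finite W"
  shows "(\<Sum>J\<in>Pow W. x ^ card J * y ^ card (W - J)) = (x + y) ^ card W"
proof -
  have "(x + y) ^ card W = (\<Prod>w\<in>W. x + y)" by simp
  also have "\<dots> = (\<Sum>J\<in>Pow W. x ^ card J * y ^ card (W - J))"
    using assms by (subst prod_add) auto
  finally show ?thesis by simp
qed

text \<open>The operator x d/dx applied to the binomial formula
  \<open>sum_Pow_power_card\<close>.\<close>

lemma sum_Pow_card_power_card:
  fixes x y :: real
  assumes "finite W"
  shows "(\<Sum>J\<in>Pow W. card J * x ^ card J * y ^ card (W - J)) = card W * x * (x + y) ^ (card W - 1)"
  using assms
proof (induction W)
  case (insert w W)
  have fin: "finite J" "w \<notin> J" if "J \<in> Pow W" for J
    using that insert.hyps by (auto intro: finite_subset)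
  let ?S = "\<Sum>J\<in>Pow W. card J * x ^ card J * y ^ card (W - J)"
  have 1: "card (insert w W - J) = Suc (card (W - J))" if "J \<in> Pow W" for J
    using fin[OF that] insert.hyps by (subst insert_Diff_if) auto
  have 2: "insert w W - insert w J = W - J" if "J \<in> Pow W" for J
    using fin[OF that] insert.hyps by auto
  have "(\<Sum>J\<in>Pow (insert w W). card J * x ^ card J * y ^ card (insert w W - J)) =
    (\<Sum>J\<in>Pow W. y * (card J * x ^ card J * y ^ card (W - J))) +
    (\<Sum>J\<in>Pow W. x * (card J * x ^ card J * y ^ card (W - J)) + x * (x ^ card J * y ^ card (W - J)))"
    unfolding sum_Pow_insert[OF insert.hyps]
    using fin 1 2 by (intro arg_cong2[where f = "(+)"] sum.cong) (simp_all add: algebra_simps)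
  also have "\<dots> = (x + y) * ?S + x * (x + y) ^ card W"
    using sum_Pow_power_card[OF insert.hyps(1), of x y]
    by (simp add: sum.distrib sum_distrib_left[symmetric] algebra_simps)
  also have "\<dots> = (card W + 1) * x * (x + y) ^ card W"
    unfolding insert.IH by (cases "card W") (simp_all add: algebra_simps)
  finally show ?case using insert.hyps by (simp add: algebra_simps)
qed auto

section \<open>Sums over assignments, split along the domain\<close>

lemma sum_PiE_insert:
  assumes "a \<notin> S"
  shows "(\<Sum>\<tau>\<in>insert a S \<rightarrow>\<^sub>E I. h \<tau>) = (\<Sum>\<tau>\<in>S \<rightarrow>\<^sub>E I. \<Sum>t\<in>I. h (\<tau>(a := t)))"
proof -
  have "(\<Sum>\<tau>\<in>insert a S \<rightarrow>\<^sub>E I. h \<tau>) = (\<Sum>(t, \<tau>)\<in>I \<times> (S \<rightarrow>\<^sub>E I). h (\<tau>(a := t)))"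
    unfolding PiE_insert_eq
    using assms by (subst sum.reindex[OF inj_combinator]) (auto intro!: sum.cong)
  also have "\<dots> = (\<Sum>\<tau>\<in>S \<rightarrow>\<^sub>E I. \<Sum>t\<in>I. h (\<tau>(a := t)))"
    by (subst sum.swap) (simp add: sum.cartesian_product)
  finally show ?thesis .
qed

lemma sum_PiE_Un:
  assumes "A \<inter> B = {}"
  shows "(\<Sum>\<sigma>\<in>A \<union> B \<rightarrow>\<^sub>E I. h \<sigma>) = (\<Sum>\<sigma>\<in>A \<rightarrow>\<^sub>E I. \<Sum>\<tau>\<in>B \<rightarrow>\<^sub>E I. h (override_on \<sigma> \<tau> B))"
proof -
  have "(\<Sum>\<sigma>\<in>A \<union> B \<rightarrow>\<^sub>E I. h \<sigma>) = (\<Sum>(\<sigma>, \<tau>)\<in>(A \<rightarrow>\<^sub>E I) \<times> (B \<rightarrow>\<^sub>E I). h (override_on \<sigma> \<tau> B))"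
  proof (rule sum.reindex_bij_witness[where j = "\<lambda>\<sigma>. (restrict \<sigma> A, restrict \<sigma> B)"
        and i = "\<lambda>(\<sigma>, \<tau>). override_on \<sigma> \<tau> B"])
    fix \<sigma> assume \<sigma>: "\<sigma> \<in> A \<union> B \<rightarrow>\<^sub>E I"
    have eq: "override_on (restrict \<sigma> A) (restrict \<sigma> B) B = \<sigma>"
      using \<sigma> by (auto simp: override_on_def fun_eq_iff restrict_def PiE_def extensional_def)
    then show "(case (restrict \<sigma> A, restrict \<sigma> B) of (\<sigma>, \<tau>) \<Rightarrow> override_on \<sigma> \<tau> B) = \<sigma>"
      "(case (restrict \<sigma> A, restrict \<sigma> B) of (\<sigma>, \<tau>) \<Rightarrow> h (override_on \<sigma> \<tau> B)) = h \<sigma>"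
      by auto
    show "(restrict \<sigma> A, restrict \<sigma> B) \<in> (A \<rightarrow>\<^sub>E I) \<times> (B \<rightarrow>\<^sub>E I)" using \<sigma> by auto
  next
    fix x assume "x \<in> (A \<rightarrow>\<^sub>E I) \<times> (B \<rightarrow>\<^sub>E I)"
    then obtain \<sigma> \<tau> where x: "x = (\<sigma>, \<tau>)" "\<sigma> \<in> A \<rightarrow>\<^sub>E I" "\<tau> \<in> B \<rightarrow>\<^sub>E I" by auto
    have "restrict (override_on \<sigma> \<tau> B) A = \<sigma>"
      using x assms by (auto simp: override_on_def fun_eq_iff restrict_def PiE_def extensional_def)
    moreover have "restrict (override_on \<sigma> \<tau> B) B = \<tau>"
      using x assms by (auto simp: override_on_def fun_eq_iff restrict_def PiE_def extensional_def)
    ultimately show "(restrict (case x of (\<sigma>, \<tau>) \<Rightarrow> override_on \<sigma> \<tau> B) A,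
        restrict (case x of (\<sigma>, \<tau>) \<Rightarrow> override_on \<sigma> \<tau> B) B) = x" using x by simp
    show "(case x of (\<sigma>, \<tau>) \<Rightarrow> override_on \<sigma> \<tau> B) \<in> A \<union> B \<rightarrow>\<^sub>E I"
      using x by (auto simp: override_on_def PiE_def extensional_def)
  qed
  then show ?thesis by (simp add: sum.cartesian_product)
qed

lemma forest_weight_cong:
  assumes "\<And>x y. x \<in> W \<Longrightarrow> y \<in> R \<union> W \<Longrightarrow> adj x y = adj' x y"
  shows "forest_weight adj R W = forest_weight adj' R W"
  using assms
proof (induction "card W" arbitrary: R W rule: less_induct)
  case less
  have "(\<Sum>J\<in>Pow W - {{}}. (\<Prod>j\<in>J. \<Sum>b\<in>R. of_bool (adj j b)) * forest_weight adj J (W - J)) =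
    (\<Sum>J\<in>Pow W - {{}}. (\<Prod>j\<in>J. \<Sum>b\<in>R. of_bool (adj' j b)) * forest_weight adj' J (W - J))"
    if "finite W"
  proof (intro sum.cong refl arg_cong2[where f = "(*)"] prod.cong)
    fix J assume "J \<in> Pow W - {{}}"
    then show "forest_weight adj J (W - J) = forest_weight adj' J (W - J)"
      using that by (intro less.hyps less.prems psubset_card_mono) auto
  qed (use less.prems in auto)
  then show ?case
    by (simp add: forest_weight.simps[of _ R W])
qed

text \<open>k (k + m)^(m-1) is the number of forests on k + m vertices with k prescribed roots. A
  vertex has at most D values next to its parent's value, and one leaf has at most E. N is imposed
  on all of L because it depends on the forest which vertices are leaves. Values already chosen are
  stored in \<sigma>, which therefore varies in the induction.\<close>

lemma sum_forest_weight_le: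
  fixes adj :: "'i \<Rightarrow> 'i \<Rightarrow> bool" and D E :: real
  assumes "finite L" "finite I"
    and D: "\<And>s. s \<in> I \<Longrightarrow> (\<Sum>t\<in>I. of_bool (adj t s)) \<le> D"
    and E: "\<And>\<sigma> a b. \<sigma> \<in> L \<rightarrow> I \<Longrightarrow> a \<in> L \<Longrightarrow> b \<in> L \<Longrightarrow> a \<noteq> b \<Longrightarrow>
      (\<Sum>t\<in>I. of_bool (adj t (\<sigma> b) \<and> N (\<sigma>(a := t)) a)) \<le> E"
    and E0: "E \<ge> 0" and D0: "D \<ge> 0"
    and "W \<noteq> {}" "R \<inter> W = {}" "R \<union> W \<subseteq> L" "\<sigma> \<in> L \<rightarrow> I"
  shows "(\<Sum>\<tau>\<in>W \<rightarrow>\<^sub>E I. of_bool (\<forall>a\<in>L. N (override_on \<sigma> \<tau> W) a) *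
      forest_weight (\<lambda>x y. adj (override_on \<sigma> \<tau> W x) (override_on \<sigma> \<tau> W y)) R W)
    \<le> card R * (real (card R) + card W) ^ (card W - 1) * D ^ (card W - 1) * E"
  using assms(7-10)
proof (induction "card W" arbitrary: W R \<sigma> rule: less_induct)
  case less
  define k where "k = real (card R)"
  define m where "m = card W"
  have finW: "finite W" and finR: "finite R" using less.prems assms(1) by (auto intro: finite_subset)
  have m0: "m > 0" using less.prems finW by (auto simp: m_def card_gt_0_iff)
  have k0: "k \<ge> 0" by (simp add: k_def)
  define c where "c = (\<lambda>t. \<Sum>b\<in>R. of_bool (adj t (\<sigma> b)) :: real)"
  have c0: "c t \<ge> 0" for t by (auto simp: c_def intro!: sum_nonneg)
  have csum: "(\<Sum>t\<in>I. c t) \<le> k * D"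
  proof -
    have "(\<Sum>t\<in>I. c t) = (\<Sum>b\<in>R. \<Sum>t\<in>I. of_bool (adj t (\<sigma> b)))"
      unfolding c_def by (rule sum.swap)
    also have "\<dots> \<le> (\<Sum>b\<in>R. D)" using less.prems by (intro sum_mono D) auto
    finally show ?thesis by (simp add: k_def)
  qed
  have Psum: "(\<Sum>\<tau>\<in>J \<rightarrow>\<^sub>E I. \<Prod>j\<in>J. c (\<tau> j)) \<le> (k * D) ^ card J" if "J \<subseteq> W" for J
  proof -
    have "finite J" using that finW by (rule finite_subset)
    then have "(\<Sum>\<tau>\<in>J \<rightarrow>\<^sub>E I. \<Prod>j\<in>J. c (\<tau> j)) = (\<Prod>j\<in>J. \<Sum>t\<in>I. c t)"
      using assms(2) by (subst prod_sum_PiE) auto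
    also have "\<dots> \<le> (k * D) ^ card J"
      using csum by (auto intro!: power_mono sum_nonneg c0)
    finally show ?thesis .
  qed
  let ?ov = "\<lambda>\<tau>. override_on \<sigma> \<tau> W"
  let ?good = "\<lambda>\<sigma>. of_bool (\<forall>a\<in>L. N \<sigma> a) :: real"
  let ?fw = "\<lambda>\<sigma>. forest_weight (\<lambda>x y. adj (\<sigma> x) (\<sigma> y))"
  have expand: "?fw (?ov \<tau>) R W = (\<Sum>J\<in>Pow W. (\<Prod>j\<in>J. c (\<tau> j)) * ?fw (?ov \<tau>) J (W - J))" for \<tau>
  proof (subst forest_weight_eq[OF finW], intro sum.cong refl arg_cong2[where f = "(*)"] prod.cong)
    fix J j assume "J \<in> Pow W" "j \<in> J"
    then show "(\<Sum>b\<in>R. of_bool (adj (?ov \<tau> j) (?ov \<tau> b))) = c (\<tau> j)"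
      using less.prems unfolding c_def by (intro sum.cong) (auto simp: override_on_def)
  qed
  \<comment> \<open>The factor 1/m gives the bounds for J = W and J \<noteq> W a common shape, whose
    sum over J is \<open>sum_Pow_card_power_card\<close> with x = k and y = m.\<close>
  have summand: "(\<Sum>\<tau>\<in>W \<rightarrow>\<^sub>E I. ?good (?ov \<tau>) * ((\<Prod>j\<in>J. c (\<tau> j)) * ?fw (?ov \<tau>) J (W - J)))
      \<le> D ^ (m - 1) * E / m * (card J * k ^ card J * real m ^ card (W - J))" if J: "J \<subseteq> W" for J
  proof (cases "J = W")
    case True
    \<comment> \<open>Every vertex is a leaf now, so any \<open>a\<close> will do: with the values
      on U fixed, N at \<open>a\<close> bounds the sum over its value by k * E, and each vertex of U
      gives k * D.\<close>
    obtain a where a: "a \<in> W" using less.prems by auto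
    define U where "U = W - {a}"
    have U: "W = insert a U" "a \<notin> U" "finite U" "card U = m - 1"
      using a finW by (auto simp: U_def m_def)
    have inner: "(\<Sum>t\<in>I. ?good (?ov (\<tau>(a := t))) * c t) \<le> k * E" if \<tau>: "\<tau> \<in> U \<rightarrow>\<^sub>E I" for \<tau>
    proof -
      define \<sigma>' where "\<sigma>' = override_on \<sigma> \<tau> U"
      have ov: "?ov (\<tau>(a := t)) = \<sigma>'(a := t)" for t
        using U by (auto simp: \<sigma>'_def override_on_def fun_eq_iff)
      have \<sigma>': "\<sigma>' \<in> L \<rightarrow> I" "\<And>b. b \<in> R \<Longrightarrow> \<sigma>' b = \<sigma> b"
        using less.prems \<tau> U by (auto simp: \<sigma>'_def override_on_def PiE_def Pi_def)
      have "(\<Sum>t\<in>I. ?good (?ov (\<tau>(a := t))) * c t) \<le>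
          (\<Sum>t\<in>I. \<Sum>b\<in>R. of_bool (adj t (\<sigma>' b) \<and> N (\<sigma>'(a := t)) a))"
        unfolding c_def sum_distrib_left
        using a less.prems \<sigma>' by (intro sum_mono) (auto simp: ov)
      also have "\<dots> = (\<Sum>b\<in>R. \<Sum>t\<in>I. of_bool (adj t (\<sigma>' b) \<and> N (\<sigma>'(a := t)) a))"
        by (rule sum.swap)
      also have "\<dots> \<le> (\<Sum>b\<in>R. E)"
        using a less.prems \<sigma>' by (intro sum_mono E) auto
      finally show ?thesis by (simp add: k_def)
    qed
    have "(\<Sum>\<tau>\<in>W \<rightarrow>\<^sub>E I. ?good (?ov \<tau>) * ((\<Prod>j\<in>J. c (\<tau> j)) * ?fw (?ov \<tau>) J (W - J))) =
        (\<Sum>\<tau>\<in>insert a U \<rightarrow>\<^sub>E I. ?good (?ov \<tau>) * (\<Prod>j\<in>insert a U. c (\<tau> j)))"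
      using True U by simp
    also have "\<dots> = (\<Sum>\<tau>\<in>U \<rightarrow>\<^sub>E I. \<Sum>t\<in>I. ?good (?ov (\<tau>(a := t))) * (\<Prod>j\<in>insert a U. c ((\<tau>(a := t)) j)))"
      using U(2) by (rule sum_PiE_insert)
    also have "\<dots> = (\<Sum>\<tau>\<in>U \<rightarrow>\<^sub>E I. (\<Prod>j\<in>U. c (\<tau> j)) * (\<Sum>t\<in>I. ?good (?ov (\<tau>(a := t))) * c t))"
    proof (intro sum.cong refl)
      fix \<tau>
      have "(\<Prod>j\<in>insert a U. c ((\<tau>(a := t)) j)) = c t * (\<Prod>j\<in>U. c (\<tau> j))" for t
        using U by (subst prod.insert) (auto intro!: arg_cong2[where f = "(*)"] prod.cong)
      then show "(\<Sum>t\<in>I. ?good (?ov (\<tau>(a := t))) * (\<Prod>j\<in>insert a U. c ((\<tau>(a := t)) j))) =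
         (\<Prod>j\<in>U. c (\<tau> j)) * (\<Sum>t\<in>I. ?good (?ov (\<tau>(a := t))) * c t)"
        by (simp add: sum_distrib_left mult_ac)
    qed
    also have "\<dots> \<le> (\<Sum>\<tau>\<in>U \<rightarrow>\<^sub>E I. (\<Prod>j\<in>U. c (\<tau> j)) * (k * E))"
      by (intro sum_mono mult_left_mono inner prod_nonneg c0) auto
    also have "\<dots> = (\<Sum>\<tau>\<in>U \<rightarrow>\<^sub>E I. \<Prod>j\<in>U. c (\<tau> j)) * (k * E)"
      by (simp add: sum_distrib_right)
    also have "\<dots> \<le> (k * D) ^ card U * (k * E)"
      using k0 E0 U by (intro mult_right_mono Psum) auto
    also have "\<dots> = D ^ (m - 1) * E / m * (m * k ^ m)"
      using m0 U by (cases m) (simp_all add: power_mult_distrib)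
    also have "\<dots> = D ^ (m - 1) * E / m * (card J * k ^ card J * real m ^ card (W - J))"
      using True by (simp add: m_def)
    finally show ?thesis .
  next
    case False
    define V where "V = W - J"
    have V: "W = J \<union> V" "J \<inter> V = {}" "finite J" "finite V" "V \<noteq> {}" "V \<subseteq> W"
      using J False finW by (auto simp: V_def intro: finite_subset)
    have cardV: "card V = m - card J" "card J < m"
      using V by (auto simp: m_def card_Un_disjoint card_gt_0_iff)
    \<comment> \<open>Bound for the deeper levels V, summed while the values on J are fixed and J
      acts as the root set; the power of m arises from |J| + |V| = m.\<close>
    define B where "B = card J * real m ^ (card V - 1) * D ^ (card V - 1) * E"
    have B0: "B \<ge> 0" using D0 E0 by (simp add: B_def)
    have inner: "(\<Sum>\<tau>'\<in>V \<rightarrow>\<^sub>E I. ?good (override_on (override_on \<sigma> \<tau> J) \<tau>' V) *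
        ?fw (override_on (override_on \<sigma> \<tau> J) \<tau>' V) J V) \<le> B" if \<tau>: "\<tau> \<in> J \<rightarrow>\<^sub>E I" for \<tau>
    proof (cases "J = {}")
      case True
      then show ?thesis using V B0 by (simp add: forest_weight_no_root)
    next
      case False
      have "card V < card W" using False V cardV by (simp add: m_def card_gt_0_iff)
      moreover have "override_on \<sigma> \<tau> J \<in> L \<rightarrow> I"
        using \<tau> less.prems J by (auto simp: override_on_def PiE_def Pi_def)
      ultimately have "(\<Sum>\<tau>'\<in>V \<rightarrow>\<^sub>E I. ?good (override_on (override_on \<sigma> \<tau> J) \<tau>' V) *
        ?fw (override_on (override_on \<sigma> \<tau> J) \<tau>' V) J V)
        \<le> card J * (real (card J) + card V) ^ (card V - 1) * D ^ (card V - 1) * E"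
        using V less.prems J by (intro less.hyps) auto
      also have "real (card J) + card V = m" using cardV by simp
      finally show ?thesis by (simp add: B_def)
    qed
    have "(\<Sum>\<tau>\<in>W \<rightarrow>\<^sub>E I. ?good (?ov \<tau>) * ((\<Prod>j\<in>J. c (\<tau> j)) * ?fw (?ov \<tau>) J (W - J))) =
        (\<Sum>\<tau>\<in>J \<union> V \<rightarrow>\<^sub>E I. ?good (?ov \<tau>) * ((\<Prod>j\<in>J. c (\<tau> j)) * ?fw (?ov \<tau>) J V))"
      using V(1) by (simp add: V_def)
    also have "\<dots> = (\<Sum>\<tau>\<in>J \<rightarrow>\<^sub>E I. \<Sum>\<tau>'\<in>V \<rightarrow>\<^sub>E I. ?good (?ov (override_on \<tau> \<tau>' V)) *
        ((\<Prod>j\<in>J. c (override_on \<tau> \<tau>' V j)) * ?fw (?ov (override_on \<tau> \<tau>' V)) J V))"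
      using V(2) by (rule sum_PiE_Un)
    also have "\<dots> = (\<Sum>\<tau>\<in>J \<rightarrow>\<^sub>E I. (\<Prod>j\<in>J. c (\<tau> j)) *
        (\<Sum>\<tau>'\<in>V \<rightarrow>\<^sub>E I. ?good (override_on (override_on \<sigma> \<tau> J) \<tau>' V) *
          ?fw (override_on (override_on \<sigma> \<tau> J) \<tau>' V) J V))"
      unfolding sum_distrib_left
    proof (intro sum.cong refl)
      fix \<tau> \<tau>'
      have "?ov (override_on \<tau> \<tau>' V) = override_on (override_on \<sigma> \<tau> J) \<tau>' V"
        using V by (auto simp: override_on_def fun_eq_iff)
      moreover have "(\<Prod>j\<in>J. c (override_on \<tau> \<tau>' V j)) = (\<Prod>j\<in>J. c (\<tau> j))"
        using V by (intro prod.cong) (auto simp: override_on_def)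
      ultimately show "?good (?ov (override_on \<tau> \<tau>' V)) *
          ((\<Prod>j\<in>J. c (override_on \<tau> \<tau>' V j)) * ?fw (?ov (override_on \<tau> \<tau>' V)) J V) =
        (\<Prod>j\<in>J. c (\<tau> j)) * (?good (override_on (override_on \<sigma> \<tau> J) \<tau>' V) *
          ?fw (override_on (override_on \<sigma> \<tau> J) \<tau>' V) J V)"
        by (simp only: mult_ac)
    qed
    also have "\<dots> \<le> (\<Sum>\<tau>\<in>J \<rightarrow>\<^sub>E I. (\<Prod>j\<in>J. c (\<tau> j)) * B)"
      by (intro sum_mono mult_left_mono inner prod_nonneg c0) auto
    also have "\<dots> \<le> (k * D) ^ card J * B"
      unfolding sum_distrib_right[symmetric] using B0 J by (intro mult_right_mono Psum)
    also have "\<dots> = D ^ (m - 1) * E / m * (card J * k ^ card J * real m ^ card (W - J))"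
    proof -
      obtain v where v: "card V = Suc v" using V by (cases "card V") auto
      then have "m - 1 = card J + v" using cardV by simp
      then show ?thesis
        using m0 v unfolding B_def V_def[symmetric] by (simp add: power_mult_distrib power_add)
    qed
    finally show ?thesis .
  qed
  have "(\<Sum>\<tau>\<in>W \<rightarrow>\<^sub>E I. ?good (?ov \<tau>) * ?fw (?ov \<tau>) R W) =
      (\<Sum>J\<in>Pow W. \<Sum>\<tau>\<in>W \<rightarrow>\<^sub>E I. ?good (?ov \<tau>) * ((\<Prod>j\<in>J. c (\<tau> j)) * ?fw (?ov \<tau>) J (W - J)))"
    unfolding expand sum_distrib_left by (rule sum.swap)
  also have "\<dots> \<le> (\<Sum>J\<in>Pow W. D ^ (m - 1) * E / m * (card J * k ^ card J * real m ^ card (W - J)))"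
    by (intro sum_mono summand) auto
  also have "\<dots> = D ^ (m - 1) * E / m * (m * k * (k + m) ^ (m - 1))"
    unfolding sum_distrib_left[symmetric] sum_Pow_card_power_card[OF finW] m_def ..
  also have "\<dots> = card R * (real (card R) + card W) ^ (card W - 1) * D ^ (card W - 1) * E"
    using m0 by (simp add: k_def m_def)
  finally show ?case .
qed

section \<open>Cumulants of bounded random variables\<close>

lemma conv_radius_fps_integral:
  fixes F :: "real fps"
  shows "fps_conv_radius (fps_integral F a) \<ge> fps_conv_radius F"
  unfolding fps_conv_radius_def
proof (rule conv_radius_geI_ex)
  fix \<rho> :: real assume \<rho>: "\<rho> > 0" "ereal \<rho> < conv_radius (fps_nth F)"
  have "summable (\<lambda>n. norm (fps_nth F n * \<rho> ^ n))"
    using \<rho> by (intro abs_summable_in_conv_radius) auto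
  then have "summable (\<lambda>n. \<rho> * norm (fps_nth F n * \<rho> ^ n))"
    by (rule summable_mult)
  then have "summable (\<lambda>n. fps_nth (fps_integral F a) (Suc n) * \<rho> ^ Suc n)"
  proof (rule summable_comparison_test'[where N = 0])
    fix n :: nat
    have "norm (inverse (real (Suc n))) * (\<rho> * norm (fps_nth F n * \<rho> ^ n)) \<le> 1 * (\<rho> * norm (fps_nth F n * \<rho> ^ n))"
      using \<rho> by (intro mult_right_mono) (auto simp: field_simps)
    then show "norm (fps_nth (fps_integral F a) (Suc n) * \<rho> ^ Suc n) \<le> \<rho> * norm (fps_nth F n * \<rho> ^ n)"
      using \<rho> by (simp add: abs_mult mult_ac)
  qed
  then have "summable (\<lambda>n. fps_nth (fps_integral F a) n * \<rho> ^ n)"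
    by (subst (asm) summable_Suc_iff)
  then show "\<exists>z. norm z = \<rho> \<and> summable (\<lambda>n. fps_nth (fps_integral F a) n * z ^ n)"
    using \<rho> by (intro exI[of _ \<rho>]) auto
qed

text \<open>Near 0 the logarithm and the integral of F'/F have the same derivative, and both vanish
  at 0. The sum \<open>g\<close> of the series replaces f, which agrees with it only near 0.\<close>

lemma has_fps_expansion_ln_real:
  fixes f :: "real \<Rightarrow> real"
  assumes f: "f has_fps_expansion F" and F0: "fps_nth F 0 = 1"
  shows "(\<lambda>x. ln (f x)) has_fps_expansion fps_integral0 (fps_deriv F * inverse F)"
proof -
  define Q where "Q = fps_deriv F * inverse F"
  define g where "g = eval_fps F"
  have rF: "fps_conv_radius F > 0" and fg: "\<forall>\<^sub>F x in nhds 0. g x = f x"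
    using f by (auto simp: has_fps_expansion_def g_def)
  have g: "g has_fps_expansion F"
    unfolding g_def using rF by (rule eval_fps_has_fps_expansion)
  have Q: "(\<lambda>x. deriv g x * inverse (g x)) has_fps_expansion Q"
    unfolding Q_def using F0 by (intro has_fps_expansion_mult has_fps_expansion_deriv has_fps_expansion_inverse g) auto
  then have rQ: "fps_conv_radius Q > 0" and evQ: "\<forall>\<^sub>F x in nhds 0. eval_fps Q x = deriv g x * inverse (g x)"
    by (auto simp: has_fps_expansion_def)
  have rK: "fps_conv_radius (fps_integral0 Q) > 0"
    using rQ conv_radius_fps_integral[of Q 0] by (rule less_le_trans)
  have rad: "\<forall>\<^sub>F x in nhds 0. ereal (norm x) < fps_conv_radius G" if "fps_conv_radius G > 0" for G :: "real fps"
  proof -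
    have "\<forall>\<^sub>F x in nhds 0. x \<in> eball 0 (fps_conv_radius G)"
      using that by (intro eventually_nhds_in_open) (auto simp: zero_ereal_def)
    then show ?thesis by eventually_elim (simp add: in_eball_iff dist_norm)
  qed
  have "isCont g 0" using has_fps_expansion_imp_continuous[OF g, of UNIV] by simp
  then have "(g \<longlongrightarrow> g 0) (nhds 0)"
    by (simp add: isCont_def tendsto_at_iff_tendsto_nhds)
  moreover have "g 0 = 1" by (simp add: g_def eval_fps_at_0 F0)
  ultimately have "(g \<longlongrightarrow> 1) (nhds 0)" by simp
  then have pos: "\<forall>\<^sub>F x in nhds 0. g x > 0"
    by (rule order_tendstoD) simp
  have "\<forall>\<^sub>F x in nhds 0. ereal (norm x) < fps_conv_radius F \<and> ereal (norm x) < fps_conv_radius (fps_integral0 Q)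
      \<and> g x > 0 \<and> eval_fps Q x = deriv g x * inverse (g x)"
    using rad[OF rF] rad[OF rK] pos evQ by eventually_elim auto
  then obtain \<epsilon> where \<epsilon>: "\<epsilon> > 0" and ev: "\<And>x. dist x 0 < \<epsilon> \<Longrightarrow>
      ereal (norm x) < fps_conv_radius F \<and> ereal (norm x) < fps_conv_radius (fps_integral0 Q)
      \<and> g x > 0 \<and> eval_fps Q x = deriv g x * inverse (g x)"
    unfolding eventually_nhds_metric by blast
  have "((\<lambda>x. ln (g x) - eval_fps (fps_integral0 Q) x) has_field_derivative 0) (at x within ball 0 \<epsilon>)"
    if "x \<in> ball 0 \<epsilon>" for x
  proof -
    have x: "ereal (norm x) < fps_conv_radius F" "ereal (norm x) < fps_conv_radius (fps_integral0 Q)"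
      "g x > 0" "eval_fps Q x = deriv g x * inverse (g x)"
      using ev[of x] that by (auto simp: dist_commute)
    have "(g has_field_derivative eval_fps (fps_deriv F) x) (at x within ball 0 \<epsilon>)"
      unfolding g_def using x(1) by (rule has_field_derivative_eval_fps)
    moreover have "deriv g x = eval_fps (fps_deriv F) x"
      unfolding g_def using has_field_derivative_eval_fps[OF x(1)] by (rule DERIV_imp_deriv)
    moreover have "(eval_fps (fps_integral0 Q) has_field_derivative eval_fps Q x) (at x within ball 0 \<epsilon>)"
      using has_field_derivative_eval_fps[OF x(2), of "ball 0 \<epsilon>"] by (simp add: fps_deriv_fps_integral)
    ultimately show ?thesis
      using x(3,4) by (auto intro!: derivative_eq_intros simp: field_simps)
  qed
  then obtain c where c: "\<And>x. x \<in> ball 0 \<epsilon> \<Longrightarrow> ln (g x) - eval_fps (fps_integral0 Q) x = c"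
    using has_field_derivative_zero_constant[of "ball 0 \<epsilon>" "\<lambda>x. ln (g x) - eval_fps (fps_integral0 Q) x"]
    by auto
  have "c = 0" using c[of 0] \<epsilon> \<open>g 0 = 1\<close> by (simp add: eval_fps_at_0)
  have "\<forall>\<^sub>F x in nhds 0. x \<in> ball 0 \<epsilon>"
    using \<epsilon> by (intro eventually_nhds_in_open) auto
  then have "\<forall>\<^sub>F x in nhds 0. eval_fps (fps_integral0 Q) x = ln (f x)"
    using fg
  proof eventually_elim
    case (elim x)
    then show ?case using c[of x] \<open>c = 0\<close> by simp
  qed
  then show ?thesis
    using rK by (simp add: has_fps_expansion_def Q_def)
qed

text \<open>Boundedness of Z dominates the exponential series for every argument, so sum and
  integral may be exchanged.\<close>

lemma mgf_has_fps_expansion: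
  fixes Z :: "'w \<Rightarrow> real"
  assumes "prob_space P" and [measurable]: "Z \<in> borel_measurable P"
    and bound: "\<And>\<omega>. \<omega> \<in> space P \<Longrightarrow> \<bar>Z \<omega>\<bar> \<le> C"
  shows "(\<lambda>t. \<integral>\<omega>. exp (t * Z \<omega>) \<partial>P) has_fps_expansion Abs_fps (\<lambda>k. (\<integral>\<omega>. Z \<omega> ^ k \<partial>P) / fact k)"
proof (intro has_fps_expansionI always_eventually allI)
  interpret prob_space P by fact
  fix u :: real
  let ?f = "\<lambda>k \<omega>. (u * Z \<omega>) ^ k / fact k"
  have bd: "norm (?f k \<omega>) \<le> (\<bar>u\<bar> * C) ^ k / fact k" if "\<omega> \<in> space P" for k \<omega>
    using bound[OF that] by (auto simp: power_abs abs_mult intro!: divide_right_mono power_mono mult_left_mono)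
  have int: "integrable P (?f k)" for k
    using bd by (intro integrable_const_bound[where B = "(\<bar>u\<bar> * C) ^ k / fact k"]) auto
  have exp_sums: "(\<lambda>k. x ^ k / fact k) sums exp x" for x :: real
    using exp_converges[of x] by (simp add: scaleR_conv_of_real field_simps)
  have "(\<lambda>k. \<integral>\<omega>. ?f k \<omega> \<partial>P) sums (\<integral>\<omega>. (\<Sum>k. ?f k \<omega>) \<partial>P)"
  proof (rule sums_integral[OF int])
    show "AE \<omega> in P. summable (\<lambda>k. norm (?f k \<omega>))"
      using summable_norm_exp[where 'a = real] by (simp only: real_scaleR_def divide_inverse_commute) simp
    show "summable (\<lambda>k. \<integral>\<omega>. norm (?f k \<omega>) \<partial>P)"
    proof (rule summable_comparison_test'[where N = 0])
      show "summable (\<lambda>k. (\<bar>u\<bar> * C) ^ k / fact k)"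
        using exp_sums by (rule sums_summable)
      fix k
      have "(\<integral>\<omega>. norm (?f k \<omega>) \<partial>P) \<le> (\<bar>u\<bar> * C) ^ k / fact k"
        using bd int by (intro integral_le_const integrable_norm) auto
      then show "norm (\<integral>\<omega>. norm (?f k \<omega>) \<partial>P) \<le> (\<bar>u\<bar> * C) ^ k / fact k"
        by simp
    qed
  qed
  also have "(\<lambda>\<omega>. \<Sum>k. ?f k \<omega>) = (\<lambda>\<omega>. exp (u * Z \<omega>))"
    using exp_sums by (auto simp: sums_iff)
  also have "(\<lambda>k. \<integral>\<omega>. ?f k \<omega> \<partial>P) = (\<lambda>k. fps_nth (Abs_fps (\<lambda>k. (\<integral>\<omega>. Z \<omega> ^ k \<partial>P) / fact k)) k * u ^ k)"
    by (simp add: power_mult_distrib mult_ac)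
  finally show "(\<lambda>k. fps_nth (Abs_fps (\<lambda>k. (\<integral>\<omega>. Z \<omega> ^ k \<partial>P) / fact k)) k * u ^ k)
      sums (\<integral>\<omega>. exp (u * Z \<omega>) \<partial>P)" .
qed

text \<open>Uniqueness of expansions resolves the definite description in \<open>cumulant\<close>.
  The shift to Suc k absorbs the denominator k + 1 that comes from integrating F'/F.\<close>

lemma cumulant_eq_fps:
  fixes Z :: "'w \<Rightarrow> real"
  assumes "prob_space P" "Z \<in> borel_measurable P" "\<And>\<omega>. \<omega> \<in> space P \<Longrightarrow> \<bar>Z \<omega>\<bar> \<le> C"
  defines "F \<equiv> Abs_fps (\<lambda>k. (\<integral>\<omega>. Z \<omega> ^ k \<partial>P) / fact k)"
  shows "cumulant P Z (Suc k) = fact k * fps_nth (fps_deriv F * inverse F) k"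
proof -
  interpret prob_space P by fact
  have "(\<lambda>t. \<integral>\<omega>. exp (t * Z \<omega>) \<partial>P) has_fps_expansion F"
    unfolding F_def by (rule mgf_has_fps_expansion[OF assms(1-3)])
  moreover have "fps_nth F 0 = 1" by (simp add: F_def prob_space)
  ultimately have "(\<lambda>t. ln (\<integral>\<omega>. exp (t * Z \<omega>) \<partial>P)) has_fps_expansion
      fps_integral0 (fps_deriv F * inverse F)"
    by (rule has_fps_expansion_ln_real)
  then have "(THE F. (\<lambda>t. ln (\<integral>\<omega>. exp (t * Z \<omega>) \<partial>P)) has_fps_expansion F) =
      fps_integral0 (fps_deriv F * inverse F)"
    by (intro the_equality real_has_fps_expansion_unique)
  then show ?thesis
    by (simp add: cumulant_def del: of_nat_Suc)
qed

lemma sum_Pow_card: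
  fixes h :: "nat \<Rightarrow> real"
  assumes "finite W"
  shows "(\<Sum>B\<in>Pow W. h (card B)) = (\<Sum>j\<le>card W. (card W choose j) * h j)"
proof -
  have "(\<Sum>B\<in>Pow W. h (card B)) = (\<Sum>j\<le>card W. \<Sum>B | B \<in> Pow W \<and> card B = j. h (card B))"
    using assms by (intro sum.group[symmetric]) (auto intro: card_mono)
  also have "\<dots> = (\<Sum>j\<le>card W. (card W choose j) * h j)"
    using assms by (intro sum.cong) (auto simp: n_subsets[symmetric])
  finally show ?thesis .
qed

text \<open>Summed over all assignments \<open>\<sigma>\<close>, the terms of a subset convolution depend only on the
  cardinalities of the two parts, so it becomes a product of exponential generating functions.\<close>

lemma sum_set_cumulant:
  fixes m :: "('v \<Rightarrow> 'i) \<Rightarrow> 'v set \<Rightarrow> real" and \<mu> :: "nat \<Rightarrow> real"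
  assumes "finite W" "a \<notin> W"
    and cong: "\<And>\<sigma> \<tau> B. finite B \<Longrightarrow> (\<And>b. b \<in> B \<Longrightarrow> \<sigma> b = \<tau> b) \<Longrightarrow> m \<sigma> B = m \<tau> B"
    and msum: "\<And>B. finite B \<Longrightarrow> (\<Sum>\<sigma>\<in>B \<rightarrow>\<^sub>E I. m \<sigma> B) = \<mu> (card B)"
    and m1: "\<And>\<sigma>. m \<sigma> {} = 1"
  defines "F \<equiv> Abs_fps (\<lambda>k. \<mu> k / fact k)"
  shows "(\<Sum>\<sigma>\<in>insert a W \<rightarrow>\<^sub>E I. set_cumulant (m \<sigma>) {a} W) =
    fact (card W) * fps_nth (fps_deriv F * inverse F) (card W)"
proof -
  have mu0: "\<mu> 0 = 1" using msum[of "{}"] m1 by simp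
  \<comment> \<open>Factors that depend on disjoint sets of labels can be summed separately.\<close>
  have split: "(\<Sum>\<sigma>\<in>A \<union> B \<rightarrow>\<^sub>E I. f \<sigma> * g \<sigma>) = (\<Sum>\<sigma>\<in>A \<rightarrow>\<^sub>E I. f \<sigma>) * (\<Sum>\<sigma>\<in>B \<rightarrow>\<^sub>E I. g \<sigma>)"
    if "A \<inter> B = {}" and f: "\<And>\<sigma> \<tau>. (\<And>x. x \<in> A \<Longrightarrow> \<sigma> x = \<tau> x) \<Longrightarrow> f \<sigma> = f \<tau>"
      and g: "\<And>\<sigma> \<tau>. (\<And>x. x \<in> B \<Longrightarrow> \<sigma> x = \<tau> x) \<Longrightarrow> g \<sigma> = g \<tau>"
    for A B :: "'v set" and f g :: "('v \<Rightarrow> 'i) \<Rightarrow> real"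
  proof -
    have "f (override_on \<sigma> \<tau> B) = f \<sigma>" "g (override_on \<sigma> \<tau> B) = g \<tau>" for \<sigma> \<tau>
      using that(1) by (auto intro!: f g simp: override_on_def)
    then show ?thesis unfolding sum_PiE_Un[OF that(1)] by (simp add: sum_product)
  qed
  \<comment> \<open>Coefficients of 1/F as an exponential generating function. In \<open>inv\<close>
    they turn out to be the sums of \<open>set_inverse\<close>, as both satisfy the recursion that
    expresses inversion.\<close>
  define \<nu> where "\<nu> = (\<lambda>n. fact n * fps_nth (inverse F) n)"
  have inv_cong: "set_inverse (m \<sigma>) B = set_inverse (m \<tau>) B"
    if "finite B" "\<And>x. x \<in> B \<Longrightarrow> \<sigma> x = \<tau> x" for \<sigma> \<tau> B
    using that by (intro set_inverse_cong cong) (auto intro: finite_subset)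
  have prod: "(\<Sum>j\<le>n. (n choose j) * (\<mu>' j * \<nu> (n - j))) =
      fact n * fps_nth (Abs_fps (\<lambda>k. \<mu>' k / fact k) * inverse F) n" for \<mu>' n
    unfolding fps_mult_nth sum_distrib_left atLeast0AtMost \<nu>_def
    by (intro sum.cong) (auto simp: binomial_fact field_simps)
  have inv: "(\<Sum>\<sigma>\<in>C \<rightarrow>\<^sub>E I. set_inverse (m \<sigma>) C) = \<nu> (card C)" if "finite C" for C
    using that
  proof (induction "card C" arbitrary: C rule: less_induct)
    case less
    have F: "F * inverse F = 1" using mu0 by (intro inverse_mult_eq_1') (simp add: F_def)
    show ?case
    proof (cases "C = {}")
      case True
      then show ?thesis using mu0 by (simp add: \<nu>_def F_def)
    next
      case False
      have "0 = (\<Sum>\<sigma>\<in>C \<rightarrow>\<^sub>E I. subset_conv (m \<sigma>) (set_inverse (m \<sigma>)) C)"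
        using False less.prems m1 by (simp add: subset_conv_set_inverse)
      also have "\<dots> = (\<Sum>B\<in>Pow C. \<Sum>\<sigma>\<in>C \<rightarrow>\<^sub>E I. m \<sigma> B * set_inverse (m \<sigma>) (C - B))"
        unfolding subset_conv_def by (rule sum.swap)
      also have "\<dots> = (\<Sum>B\<in>Pow C. \<mu> (card B) * (\<Sum>\<sigma>\<in>C - B \<rightarrow>\<^sub>E I. set_inverse (m \<sigma>) (C - B)))"
      proof (intro sum.cong refl)
        fix B assume "B \<in> Pow C"
        then have B: "B \<subseteq> C" "finite B" "B \<union> (C - B) = C" using less.prems by (auto intro: finite_subset)
        have "(\<Sum>\<sigma>\<in>B \<union> (C - B) \<rightarrow>\<^sub>E I. m \<sigma> B * set_inverse (m \<sigma>) (C - B)) =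
            (\<Sum>\<sigma>\<in>B \<rightarrow>\<^sub>E I. m \<sigma> B) * (\<Sum>\<sigma>\<in>C - B \<rightarrow>\<^sub>E I. set_inverse (m \<sigma>) (C - B))"
          using B(2) less.prems by (intro split cong inv_cong) auto
        then show "(\<Sum>\<sigma>\<in>C \<rightarrow>\<^sub>E I. m \<sigma> B * set_inverse (m \<sigma>) (C - B)) =
            \<mu> (card B) * (\<Sum>\<sigma>\<in>C - B \<rightarrow>\<^sub>E I. set_inverse (m \<sigma>) (C - B))"
          unfolding B(3) msum[OF B(2)] .
      qed
      also have "\<dots> = \<mu> 0 * (\<Sum>\<sigma>\<in>C \<rightarrow>\<^sub>E I. set_inverse (m \<sigma>) C) +
          (\<Sum>B\<in>Pow C - {{}}. \<mu> (card B) * (\<Sum>\<sigma>\<in>C - B \<rightarrow>\<^sub>E I. set_inverse (m \<sigma>) (C - B)))"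
        using less.prems by (subst sum.remove[of _ "{}"]) auto
      also have "(\<Sum>B\<in>Pow C - {{}}. \<mu> (card B) * (\<Sum>\<sigma>\<in>C - B \<rightarrow>\<^sub>E I. set_inverse (m \<sigma>) (C - B))) =
          (\<Sum>B\<in>Pow C - {{}}. \<mu> (card B) * \<nu> (card C - card B))"
      proof (intro sum.cong refl arg_cong2[where f = "(*)"])
        fix B assume B: "B \<in> Pow C - {{}}"
        then have "(\<Sum>\<sigma>\<in>C - B \<rightarrow>\<^sub>E I. set_inverse (m \<sigma>) (C - B)) = \<nu> (card (C - B))"
          using less.prems by (intro less.hyps psubset_card_mono) auto
        then show "(\<Sum>\<sigma>\<in>C - B \<rightarrow>\<^sub>E I. set_inverse (m \<sigma>) (C - B)) = \<nu> (card C - card B)"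
          using B less.prems finite_subset[of B C] by (simp add: card_Diff_subset)
      qed
      also have "\<dots> = (\<Sum>B\<in>Pow C. \<mu> (card B) * \<nu> (card C - card B)) - \<mu> 0 * \<nu> (card C)"
        using less.prems by (simp add: sum_diff1)
      also have "(\<Sum>B\<in>Pow C. \<mu> (card B) * \<nu> (card C - card B)) = 0"
        using less.prems False F prod[where \<mu>' = \<mu> and n = "card C"]
        by (simp add: sum_Pow_card[OF less.prems, of "\<lambda>j. \<mu> j * \<nu> (card C - j)"] F_def)
      finally show ?thesis using mu0 by simp
    qed
  qed
  have "(\<Sum>\<sigma>\<in>insert a W \<rightarrow>\<^sub>E I. set_cumulant (m \<sigma>) {a} W) =
      (\<Sum>B\<in>Pow W. \<Sum>\<sigma>\<in>insert a W \<rightarrow>\<^sub>E I. m \<sigma> (insert a B) * set_inverse (m \<sigma>) (W - B))"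
    unfolding set_cumulant_def subset_conv_def by (subst sum.swap) simp
  also have "\<dots> = (\<Sum>B\<in>Pow W. \<mu> (Suc (card B)) * \<nu> (card W - card B))"
  proof (intro sum.cong refl)
    fix B assume B: "B \<in> Pow W"
    then have fin: "finite B" and a: "a \<notin> B" and eq: "insert a W = insert a B \<union> (W - B)"
      using assms(1,2) by (auto intro: finite_subset)
    have "(\<Sum>\<sigma>\<in>insert a B \<union> (W - B) \<rightarrow>\<^sub>E I. m \<sigma> (insert a B) * set_inverse (m \<sigma>) (W - B)) =
      (\<Sum>\<sigma>\<in>insert a B \<rightarrow>\<^sub>E I. m \<sigma> (insert a B)) * (\<Sum>\<sigma>\<in>W - B \<rightarrow>\<^sub>E I. set_inverse (m \<sigma>) (W - B))"
      using assms(1,2) fin by (intro split cong inv_cong) auto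
    also have "\<dots> = \<mu> (Suc (card B)) * \<nu> (card W - card B)"
      using msum[of "insert a B"] inv[of "W - B"] fin a B assms(1) by (simp add: card_Diff_subset)
    finally show "(\<Sum>\<sigma>\<in>insert a W \<rightarrow>\<^sub>E I. m \<sigma> (insert a B) * set_inverse (m \<sigma>) (W - B)) =
      \<mu> (Suc (card B)) * \<nu> (card W - card B)" using eq by simp
  qed
  also have "\<dots> = fact (card W) * fps_nth (Abs_fps (\<lambda>k. \<mu> (Suc k) / fact k) * inverse F) (card W)"
    using prod[where \<mu>' = "\<lambda>k. \<mu> (Suc k)" and n = "card W"]
    by (simp add: sum_Pow_card[OF assms(1), of "\<lambda>j. \<mu> (Suc j) * \<nu> (card W - j)"])
  also have "Abs_fps (\<lambda>k. \<mu> (Suc k) / fact k) = fps_deriv F"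
    by (simp add: fps_eq_iff F_def del: of_nat_Suc)
  finally show ?thesis .
qed

section \<open>Homogeneity\<close>

lemma space_borel_of_topology [simp]: "space (borel_of_topology T) = topspace T"
  unfolding borel_of_topology_def by (rule space_measure_of) (auto dest: openin_subset)

lemma sets_borel_of_topology: "sets (borel_of_topology T) = sigma_sets (topspace T) {U. openin T U}"
  unfolding borel_of_topology_def by (rule sets_measure_of) (auto dest: openin_subset)

lemma openin_in_sets_borel: "openin T U \<Longrightarrow> U \<in> sets (borel_of_topology T)"
  by (simp add: sets_borel_of_topology)

lemma measurable_continuous_map:
  assumes "continuous_map S T f" "sets M = sets (borel_of_topology S)" "sets N = sets (borel_of_topology T)"
  shows "f \<in> measurable M N"
proof -
  have "f \<in> measurable (borel_of_topology S) (sigma (topspace T) {U. openin T U})"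
  proof (rule measurable_measure_of)
    show "{U. openin T U} \<subseteq> Pow (topspace T)" by (auto dest: openin_subset)
    show "f \<in> space (borel_of_topology S) \<rightarrow> topspace T"
      using assms(1) by (auto simp: continuous_map_def)
    fix U assume "U \<in> {U. openin T U}"
    then have "openin S {x \<in> topspace S. f x \<in> U}"
      using assms(1) by (simp add: continuous_map_def)
    moreover have "f -` U \<inter> space (borel_of_topology S) = {x \<in> topspace S. f x \<in> U}" by auto
    ultimately show "f -` U \<inter> space (borel_of_topology S) \<in> sets (borel_of_topology S)"
      by (simp add: openin_in_sets_borel)
  qed
  then show ?thesis
    using assms(2,3) by (simp add: borel_of_topology_def cong: measurable_cong_sets)
qed

lemma isometry_continuous_map:
  assumes "Metric_space M d" "Metric_space M' d'" "f \<in> M \<rightarrow> M'"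
    and "\<And>x y. x \<in> M \<Longrightarrow> y \<in> M \<Longrightarrow> d' (f x) (f y) = d x y"
  shows "continuous_map (Metric_space.mtopology M d) (Metric_space.mtopology M' d') f"
proof -
  interpret Metric_space M d by fact
  show ?thesis
    using assms by (subst metric_continuous_map) auto
qed

text \<open>The preimage of A under multiplication by h is the translate of A by the inverse of h,
  so this is left invariance of Haar measure.\<close>

lemma (in compact_topological_group) distr_haar_left_mult:
  assumes \<nu>: "haar_probability G T \<nu>" and h: "h \<in> carrier G"
  shows "(\<lambda>g. h \<otimes> g) \<in> measurable \<nu> \<nu>" "distr \<nu> \<nu> (\<lambda>g. h \<otimes> g) = \<nu>"
proof -
  have sets: "sets \<nu> = sets (borel_of_topology T)" using \<nu> by (simp add: haar_probability_def)
  then have space: "space \<nu> = carrier G" using topspace_eq sets_eq_imp_space_eq[of \<nu>] by simp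
  have "continuous_map T (prod_topology T T) (\<lambda>g. (h, g))"
    using h topspace_eq by (auto intro!: continuous_map_pairedI)
  from continuous_map_compose[OF this continuous_mult]
  have "continuous_map T T (\<lambda>g. h \<otimes> g)" by (simp add: o_def)
  then show meas: "(\<lambda>g. h \<otimes> g) \<in> measurable \<nu> \<nu>"
    using sets by (intro measurable_continuous_map[of T T])
  show "distr \<nu> \<nu> (\<lambda>g. h \<otimes> g) = \<nu>"
  proof (rule measure_eqI)
    fix A assume "A \<in> sets (distr \<nu> \<nu> (\<lambda>g. h \<otimes> g))"
    then have A: "A \<in> sets \<nu>" by simp
    then have "A \<subseteq> carrier G" using sets.sets_into_space space by blast
    have "(\<lambda>g. h \<otimes> g) -` A \<inter> space \<nu> = inv h <# A"
    proof (intro equalityI subsetI)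
      fix g assume "g \<in> (\<lambda>g. h \<otimes> g) -` A \<inter> space \<nu>"
      then have "g \<in> carrier G" "h \<otimes> g \<in> A" by (auto simp: space)
      moreover from this have "g = inv h \<otimes> (h \<otimes> g)" using h by (simp add: m_assoc[symmetric])
      ultimately show "g \<in> inv h <# A" by (auto simp: l_coset_def)
    next
      fix g assume "g \<in> inv h <# A"
      then obtain a where a: "a \<in> A" "g = inv h \<otimes> a" by (auto simp: l_coset_def)
      then have "a \<in> carrier G" using \<open>A \<subseteq> carrier G\<close> by auto
      with a h show "g \<in> (\<lambda>g. h \<otimes> g) -` A \<inter> space \<nu>"
        by (simp add: space m_assoc[symmetric])
    qed
    then show "emeasure (distr \<nu> \<nu> (\<lambda>g. h \<otimes> g)) A = emeasure \<nu> A"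
      using A meas h \<nu> by (simp add: emeasure_distr haar_probability_def)
  qed simp
qed

text \<open>The projection onto cosets intertwines the two translations by h, so invariance descends
  from Haar measure. Translation of cosets is an isometry, hence measurable.\<close>

lemma (in compact_topological_group) distr_quotient_measure_translation:
  assumes \<nu>: "haar_probability G T \<nu>" and h: "h \<in> carrier G" and K: "subgroup K G"
    and D: "invariant_quotient_distance G T K dGK"
  defines "\<mu>' \<equiv> quotient_measure G K dGK \<nu>"
  shows "(\<lambda>C. h <# C) \<in> measurable \<mu>' \<mu>'" "distr \<mu>' \<mu>' (\<lambda>C. h <# C) = \<mu>'"
proof -
  let ?Q = "Metric_space.mtopology (lcosets K) dGK"
  let ?\<pi> = "\<lambda>g. g <# K"
  let ?L = "\<lambda>C. h <# C"
  have Kc: "K \<subseteq> carrier G" using K by (rule subgroup.subset)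
  have ms: "Metric_space (lcosets K) dGK" and q: "quotient_map T ?Q ?\<pi>"
    and inv: "\<And>h C D. h \<in> carrier G \<Longrightarrow> C \<in> lcosets K \<Longrightarrow> D \<in> lcosets K \<Longrightarrow> dGK (h <# C) (h <# D) = dGK C D"
    using D by (auto simp: invariant_quotient_distance_def)
  have sets\<nu>: "sets \<nu> = sets (borel_of_topology T)" using \<nu> by (simp add: haar_probability_def)
  have sets\<mu>': "sets \<mu>' = sets (borel_of_topology ?Q)" by (simp add: \<mu>'_def quotient_measure_def)
  have space: "space \<nu> = carrier G" using topspace_eq sets_eq_imp_space_eq[OF sets\<nu>] by simp
  have \<pi>: "?\<pi> \<in> measurable \<nu> (borel_of_topology ?Q)"
    using quotient_imp_continuous_map[OF q] sets\<nu> by (rule measurable_continuous_map) simp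
  have \<pi>': "?\<pi> \<in> measurable \<nu> \<mu>'" using \<pi> sets\<mu>' by (simp cong: measurable_cong_sets)
  have \<mu>'_eq: "\<mu>' = distr \<nu> \<mu>' ?\<pi>"
    unfolding \<mu>'_def quotient_measure_def by (intro distr_cong) auto
  have "?L \<in> lcosets K \<rightarrow> lcosets K"
    using h Kc by (auto simp: LCOSETS_def lcos_m_assoc)
  then have "continuous_map ?Q ?Q ?L"
    using ms inv h by (intro isometry_continuous_map) auto
  then show L: "?L \<in> measurable \<mu>' \<mu>'"
    using sets\<mu>' by (intro measurable_continuous_map[of ?Q ?Q])
  note l = distr_haar_left_mult[OF \<nu> h]
  have "distr \<mu>' \<mu>' ?L = distr (distr \<nu> \<mu>' ?\<pi>) \<mu>' ?L" using \<mu>'_eq by simp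
  also have "\<dots> = distr \<nu> \<mu>' (?L \<circ> ?\<pi>)" using L \<pi>' by (rule distr_distr)
  also have "\<dots> = distr \<nu> \<mu>' (?\<pi> \<circ> (\<lambda>g. h \<otimes> g))"
    using h Kc by (intro distr_cong) (auto simp: space lcos_m_assoc)
  also have "\<dots> = distr (distr \<nu> \<nu> (\<lambda>g. h \<otimes> g)) \<mu>' ?\<pi>"
    using \<pi>' l(1) by (rule distr_distr[symmetric])
  also have "\<dots> = \<mu>'" using l(2) \<mu>'_eq by simp
  finally show "distr \<mu>' \<mu>' ?L = \<mu>'" .
qed

text \<open>What the rest of the proof uses of homogeneity: the group and its coset space no longer
  appear.\<close>

locale transitive_mm_space = mm_space M d \<mu> for M :: "'a set" and d and \<mu> +
  assumes transitive: "\<And>x y. x \<in> M \<Longrightarrow> y \<in> M \<Longrightarrow>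
    \<exists>g\<in>measurable \<mu> \<mu>. distr \<mu> \<mu> g = \<mu> \<and> (\<forall>u\<in>M. \<forall>v\<in>M. d (g u) (g v) = d u v) \<and> g x = y"

lemma compact_homogeneous_imp_transitive:
  assumes "compact_homogeneous_space TYPE('g) M d \<mu>"
  shows "transitive_mm_space M d \<mu>"
proof -
  from assms obtain G :: "'g monoid" and T K dGK \<nu> f where
    mm: "mm_space M d \<mu>" and G: "compact_topological_group G T" and K: "subgroup K G"
    and \<nu>: "haar_probability G T \<nu>" and D: "invariant_quotient_distance G T K dGK"
    and iso: "mm_isomorphism M d \<mu> (lcosets\<^bsub>G\<^esub> K) dGK (quotient_measure G K dGK \<nu>) f"
    unfolding compact_homogeneous_space_def by blast
  interpret mm_space M d \<mu> by fact
  interpret G: compact_topological_group G T by fact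
  define \<mu>' where "\<mu>' = quotient_measure G K dGK \<nu>"
  let ?Q = "lcosets\<^bsub>G\<^esub> K"
  have bij: "bij_betw f M ?Q" and f_iso: "\<And>u v. u \<in> M \<Longrightarrow> v \<in> M \<Longrightarrow> dGK (f u) (f v) = d u v"
    and f: "f \<in> measurable \<mu> \<mu>'" "distr \<mu> \<mu>' f = \<mu>'"
    using iso by (auto simp: mm_isomorphism_def \<mu>'_def)
  have ms: "Metric_space ?Q dGK"
    and inv: "\<And>h C D. h \<in> carrier G \<Longrightarrow> C \<in> ?Q \<Longrightarrow> D \<in> ?Q \<Longrightarrow> dGK (h <#\<^bsub>G\<^esub> C) (h <#\<^bsub>G\<^esub> D) = dGK C D"
    using D by (auto simp: invariant_quotient_distance_def)
  have sets\<mu>': "sets \<mu>' = sets (borel_of_topology (Metric_space.mtopology ?Q dGK))"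
    by (simp add: \<mu>'_def quotient_measure_def)
  have Kc: "K \<subseteq> carrier G" using K by (rule subgroup.subset)
  define f' where "f' = inv_into M f"
  have f'_in: "f' C \<in> M" and ff': "f (f' C) = C" if "C \<in> ?Q" for C
    using bij that by (auto simp: f'_def bij_betw_def inv_into_into f_inv_into_f)
  have f'f: "f' (f u) = u" if "u \<in> M" for u
    using bij that by (auto simp: f'_def bij_betw_def)
  have f_in: "f u \<in> ?Q" if "u \<in> M" for u using bij that by (auto simp: bij_betw_def)
  have f'_iso: "d (f' C) (f' D) = dGK C D" if "C \<in> ?Q" "D \<in> ?Q" for C D
    using f_iso[of "f' C" "f' D"] that by (simp add: f'_in ff')
  \<comment> \<open>\<open>mm_isomorphism\<close> says nothing about the inverse; it is measurable
    because it is an isometry and hence continuous.\<close>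
  have f': "f' \<in> measurable \<mu>' \<mu>"
    using Metric_space_axioms ms f'_in f'_iso sets\<mu>' sets_eq_borel
    by (intro measurable_continuous_map[OF isometry_continuous_map]) auto
  have space\<mu>: "space \<mu> = M" using sets_eq_imp_space_eq[OF sets_eq_borel] by simp
  have distr_f': "distr \<mu>' \<mu> f' = \<mu>"
  proof -
    have "distr \<mu>' \<mu> f' = distr (distr \<mu> \<mu>' f) \<mu> f'" using f by simp
    also have "\<dots> = distr \<mu> \<mu> (f' \<circ> f)" using f' f(1) by (rule distr_distr)
    also have "\<dots> = distr \<mu> \<mu> (\<lambda>x. x)" using f'f space\<mu> by (intro distr_cong) auto
    finally show ?thesis by simp
  qed
  show ?thesis
  proof
    fix x y assume xy: "x \<in> M" "y \<in> M"
    obtain a b where a: "a \<in> carrier G" "f x = a <#\<^bsub>G\<^esub> K" and b: "b \<in> carrier G" "f y = b <#\<^bsub>G\<^esub> K"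
      using f_in[OF xy(1)] f_in[OF xy(2)] by (auto simp: LCOSETS_def)
    \<comment> \<open>This element moves the coset of \<open>a\<close> to that of \<open>b\<close>;
      its translation, conjugated by f, takes x to y.\<close>
    define h where "h = b \<otimes>\<^bsub>G\<^esub> inv\<^bsub>G\<^esub> a"
    have h: "h \<in> carrier G" using a b by (simp add: h_def)
    let ?L = "\<lambda>C. h <#\<^bsub>G\<^esub> C"
    have L_in: "?L C \<in> ?Q" if "C \<in> ?Q" for C
      using h Kc that by (auto simp: LCOSETS_def G.lcos_m_assoc)
    note L = G.distr_quotient_measure_translation[OF \<nu> h K D, folded \<mu>'_def]
    have Lf: "?L \<circ> f \<in> measurable \<mu> \<mu>'" using f(1) L(1) by (rule measurable_comp)
    define g where "g = f' \<circ> (?L \<circ> f)"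
    have "g \<in> measurable \<mu> \<mu>" unfolding g_def using Lf f' by (rule measurable_comp)
    moreover have "distr \<mu> \<mu> g = \<mu>"
      unfolding g_def using distr_distr[OF f' Lf] distr_distr[OF L(1) f(1)] f(2) L(2) distr_f' by simp
    moreover have "\<forall>u\<in>M. \<forall>v\<in>M. d (g u) (g v) = d u v"
      using h by (simp add: g_def f'_iso L_in f_in inv f_iso)
    moreover have "g x = y"
    proof -
      have "?L (f x) = f y" using a b Kc h by (simp add: G.lcos_m_assoc h_def G.m_assoc)
      then show ?thesis using f'f[OF xy(2)] by (simp add: g_def)
    qed
    ultimately show "\<exists>g\<in>measurable \<mu> \<mu>. distr \<mu> \<mu> g = \<mu> \<and> (\<forall>u\<in>M. \<forall>v\<in>M. d (g u) (g v) = d u v) \<and> g x = y"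
      by blast
  qed
qed

section \<open>Integration on a space with a transitive group of isometries\<close>

context transitive_mm_space
begin

lemma space_eq: "space \<mu> = M"
  using sets_eq_imp_space_eq[OF sets_eq_borel] by simp

text \<open>The product sigma-algebra is meant, not the Borel sets of the product topology.
  Separability makes d a countable infimum of sums of functions of one variable.\<close>

lemma measurable_distance [measurable]: "(\<lambda>(x, y). d x y) \<in> borel_measurable (\<mu> \<Otimes>\<^sub>M \<mu>)"
proof -
  obtain C where C: "countable C" "C \<subseteq> M" "mtopology closure_of C = M"
    using separable by (auto simp: separable_space_def)
  have [measurable]: "(\<lambda>x. d x c) \<in> borel_measurable \<mu>" if "c \<in> C" for c
  proof (rule borel_measurableI_less)
    fix t
    have "{x \<in> space \<mu>. d x c < t} = mball c t"
      using that C(2) by (auto simp: space_eq commute)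
    then show "{x \<in> space \<mu>. d x c < t} \<in> sets \<mu>"
      by (simp add: sets_eq_borel openin_in_sets_borel)
  qed
  have bdd: "bdd_below ((\<lambda>c. d x c + d y c) ` C)" for x y
    by (rule bdd_belowI[of _ 0]) auto
  have eq: "d x y = (INF c\<in>C. d x c + d y c)" if xy: "x \<in> M" "y \<in> M" for x y
  proof (rule antisym)
    have "C \<noteq> {}" using C(3) xy by auto
    then show "d x y \<le> (INF c\<in>C. d x c + d y c)"
      using C(2) xy triangle[of x _ y] by (intro cINF_greatest) (auto simp: commute)
    show "(INF c\<in>C. d x c + d y c) \<le> d x y"
    proof (rule field_le_epsilon)
      fix e :: real assume "e > 0"
      have "x \<in> mtopology closure_of C" using C(3) xy by simp
      then obtain c where c: "c \<in> C" "d x c < e / 2"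
        using \<open>e > 0\<close> half_gt_zero[of e] unfolding metric_closure_of in_mball by blast
      then have "d y c \<le> d x y + d x c"
        using C(2) xy triangle[of y x c] by (auto simp: commute)
      with c have "d x c + d y c \<le> d x y + e" by simp
      then show "(INF c\<in>C. d x c + d y c) \<le> d x y + e"
        using cINF_lower[OF bdd c(1), of x y] by simp
    qed
  qed
  have "(\<lambda>z. INF c\<in>C. d (fst z) c + d (snd z) c) \<in> borel_measurable (\<mu> \<Otimes>\<^sub>M \<mu>)"
  proof (rule borel_measurable_cINF[OF C(1) _ bdd])
    fix c assume [measurable]: "c \<in> C"
    show "(\<lambda>z. d (fst z) c + d (snd z) c) \<in> borel_measurable (\<mu> \<Otimes>\<^sub>M \<mu>)"
      by measurable
  qed
  then show ?thesis
    by (rule measurable_cong[THEN iffD2, rotated]) (auto simp: space_pair_measure space_eq eq)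
qed

text \<open>Given the coordinate \<open>j\<close> shared by \<open>F\<close> and \<open>H\<close>, the conditional expectation of \<open>F\<close> is
  constant: a measure-preserving isometry moves any value of this coordinate to any other.\<close>

lemma integral_mult_invariant:
  fixes F H :: "('k \<Rightarrow> 'a) \<Rightarrow> real" and N :: "'k set"
  assumes fin: "finite N" and UV: "U \<subseteq> N" "V \<subseteq> N" "U \<inter> V \<subseteq> {j}" and j: "j \<in> N"
    and F [measurable]: "F \<in> borel_measurable (PiM N (\<lambda>_. \<mu>))"
    and H [measurable]: "H \<in> borel_measurable (PiM N (\<lambda>_. \<mu>))"
    and F_bdd: "\<And>x. x \<in> space (PiM N (\<lambda>_. \<mu>)) \<Longrightarrow> \<bar>F x\<bar> \<le> C"
    and H_bdd: "\<And>x. x \<in> space (PiM N (\<lambda>_. \<mu>)) \<Longrightarrow> \<bar>H x\<bar> \<le> C'"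
    and F_dep: "\<And>x y. (\<And>k. k \<in> U \<Longrightarrow> x k = y k) \<Longrightarrow> F x = F y"
    and H_dep: "\<And>x y. (\<And>k. k \<in> V \<Longrightarrow> x k = y k) \<Longrightarrow> H x = H y"
    and F_inv: "\<And>g x. \<forall>u\<in>M. \<forall>v\<in>M. d (g u) (g v) = d u v \<Longrightarrow> (\<And>k. k \<in> N \<Longrightarrow> x k \<in> M) \<Longrightarrow>
      F (g \<circ> x) = F x"
  shows "(\<integral>x. F x * H x \<partial>PiM N (\<lambda>_. \<mu>)) = (\<integral>x. F x \<partial>PiM N (\<lambda>_. \<mu>)) * (\<integral>x. H x \<partial>PiM N (\<lambda>_. \<mu>))"
proof -
  interpret \<mu>: prob_space \<mu> by (rule prob)
  interpret product_prob_space "\<lambda>_ :: 'k. \<mu>" by unfold_locales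
  \<comment> \<open>F is integrated over A, the coordinates in U other than j. The outer coordinates
    B contain j and everything on which H depends. If U and V are disjoint, j may be any
    index.\<close>
  define A where "A = U - {j}"
  define B where "B = N - A"
  have AB: "B \<inter> A = {}" "B \<union> A = N" "finite A" "finite B" "j \<in> B" "V \<subseteq> B" "U \<subseteq> insert j A"
    using fin UV j by (auto simp: A_def B_def intro: finite_subset)
  let ?P = "\<lambda>I. PiM I (\<lambda>_ :: 'k. \<mu>)"
  interpret PN: prob_space "?P N" by (rule prob_space_PiM) (rule prob)
  interpret PA: prob_space "?P A" by (rule prob_space_PiM) (rule prob)
  interpret PB: prob_space "?P B" by (rule prob_space_PiM) (rule prob)
  have fold: "(\<integral>x. f x \<partial>?P N) = (\<integral>x. (\<integral>y. f (merge B A (x, y)) \<partial>?P A) \<partial>?P B)"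
    if "integrable (?P N) f" for f :: "_ \<Rightarrow> real"
    using product_integral_fold[of B A f] that AB by simp
  have int: "integrable (?P N) F" "integrable (?P N) H"
    using F_bdd H_bdd
    by (auto intro!: PN.integrable_const_bound[of F C] PN.integrable_const_bound[of H C'] AE_I2)
  have intFH: "integrable (?P N) (\<lambda>x. F x * H x)"
  proof (rule PN.integrable_const_bound)
    show "AE x in ?P N. norm (F x * H x) \<le> C * C'"
    proof (rule AE_I2)
      fix x assume x: "x \<in> space (?P N)"
      have "C \<ge> 0" using F_bdd[OF x] by linarith
      then show "norm (F x * H x) \<le> C * C'"
        using F_bdd[OF x] H_bdd[OF x] by (auto simp: abs_mult intro!: mult_mono)
    qed
  qed auto
  obtain x0 where x0: "x0 \<in> space (?P B)" using PB.not_empty by blast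
  define c where "c = (\<lambda>x. \<integral>y. F (merge B A (x, y)) \<partial>?P A)"
  have const: "c x = c x0" if x: "x \<in> space (?P B)" for x
  proof -
    have "x j \<in> M" "x0 j \<in> M" using x x0 AB by (auto simp: space_PiM space_eq)
    then obtain g where g: "g \<in> measurable \<mu> \<mu>" "distr \<mu> \<mu> g = \<mu>"
      "\<forall>u\<in>M. \<forall>v\<in>M. d (g u) (g v) = d u v" "g (x j) = x0 j"
      using transitive by blast
    have meas: "(\<lambda>y. F (merge B A (x0, y))) \<in> borel_measurable (?P A)"
    proof -
      have "(\<lambda>y. merge B A (x0, y)) \<in> measurable (?P A) (?P (B \<union> A))"
        using x0 by (intro measurable_compose[OF _ measurable_merge]) auto
      then show ?thesis using F unfolding AB(2) by (rule measurable_compose)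
    qed
    have gA: "compose A g \<in> measurable (?P A) (?P A)"
    proof -
      have "(\<lambda>y. \<lambda>k\<in>A. g (y k)) \<in> measurable (?P A) (?P A)"
        using g(1) by (intro measurable_restrict measurable_compose[OF measurable_component_singleton]) auto
      then show ?thesis by (simp add: compose_def[abs_def])
    qed
    \<comment> \<open>Change of variables: g preserves \<mu> in each coordinate, so y may be
      replaced by its image under g.\<close>
    have "c x0 = (\<integral>y. F (merge B A (x0, y)) \<partial>distr (?P A) (?P A) (compose A g))"
      unfolding c_def using distr_PiM_finite_prob_space'[of A "\<lambda>_. \<mu>" "\<lambda>_. \<mu>" g] AB g prob by simp
    also have "\<dots> = (\<integral>y. F (merge B A (x0, compose A g y)) \<partial>?P A)"
      using gA meas by (rule integral_distr)
    also have "\<dots> = c x"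
      unfolding c_def
    proof (intro Bochner_Integration.integral_cong refl)
      fix y assume y: "y \<in> space (?P A)"
      \<comment> \<open>On A both arguments take the value g (y k), and at j both equal x0 j = g (x
        j); F sees no other coordinate.\<close>
      have "F (merge B A (x0, compose A g y)) = F (g \<circ> merge B A (x, y))"
        using AB g(4) by (intro F_dep) (auto simp: merge_def compose_def)
      also have "\<dots> = F (merge B A (x, y))"
        using x y AB by (intro F_inv g(3)) (auto simp: merge_def space_PiM space_eq)
      finally show "F (merge B A (x0, compose A g y)) = F (merge B A (x, y))" .
    qed
    finally show ?thesis ..
  qed
  have H_merge: "H (merge B A (x, y)) = H x" for x y
    using AB by (intro H_dep) (auto simp: merge_def)
  have "(\<integral>x. F x * H x \<partial>?P N) = (\<integral>x. c x * H x \<partial>?P B)"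
    by (simp add: fold[OF intFH] c_def H_merge)
  also have "\<dots> = (\<integral>x. c x0 * H x \<partial>?P B)"
    using const by (intro Bochner_Integration.integral_cong) auto
  also have "\<dots> = c x0 * (\<integral>x. H x \<partial>?P B)" by simp
  also have "(\<integral>x. H x \<partial>?P B) = (\<integral>x. H x \<partial>?P N)"
    by (simp add: fold[OF int(2)] H_merge PA.prob_space)
  also have "c x0 = (\<integral>x. c x \<partial>?P B)"
  proof -
    have "(\<integral>x. c x \<partial>?P B) = (\<integral>x. c x0 \<partial>?P B)"
      using const by (intro Bochner_Integration.integral_cong) auto
    then show ?thesis by (simp add: PB.prob_space)
  qed
  also have "\<dots> = (\<integral>x. F x \<partial>?P N)" by (simp add: fold[OF int(1)] c_def)
  finally show ?thesis .
qed

end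

section \<open>The cumulants of sums over index tuples\<close>

lemma card_PiE_restricted_le:
  assumes "Q \<subseteq> {1..p}"
  shows "card {t \<in> {1..p} \<rightarrow>\<^sub>E {1..n}. \<forall>a\<in>Q. t a \<in> S a} \<le> (\<Prod>a\<in>Q. card (S a \<inter> {1..n})) * n ^ (p - card Q)"
proof -
  have fin: "finite Q" using assms by (rule finite_subset) simp
  have "{t \<in> {1..p} \<rightarrow>\<^sub>E {1..n}. \<forall>a\<in>Q. t a \<in> S a} =
      (\<Pi>\<^sub>E k\<in>{1..p}. if k \<in> Q then S k \<inter> {1..n} else {1..n})"
  proof (rule Set.set_eqI)
    fix t
    have "t k \<in> (if k \<in> Q then S k \<inter> {1..n} else {1..n}) \<longleftrightarrow> t k \<in> {1..n} \<and> (k \<in> Q \<longrightarrow> t k \<in> S k)" for k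
      by auto
    then show "t \<in> {t \<in> {1..p} \<rightarrow>\<^sub>E {1..n}. \<forall>a\<in>Q. t a \<in> S a} \<longleftrightarrow>
        t \<in> (\<Pi>\<^sub>E k\<in>{1..p}. if k \<in> Q then S k \<inter> {1..n} else {1..n})"
      using assms unfolding mem_Collect_eq PiE_iff by blast
  qed
  then have "card {t \<in> {1..p} \<rightarrow>\<^sub>E {1..n}. \<forall>a\<in>Q. t a \<in> S a} =
      (\<Prod>k\<in>{1..p}. card (if k \<in> Q then S k \<inter> {1..n} else {1..n}))"
    by (simp add: card_PiE)
  also have "\<dots> = (\<Prod>k\<in>{1..p} - Q. card (if k \<in> Q then S k \<inter> {1..n} else {1..n})) *
      (\<Prod>k\<in>Q. card (if k \<in> Q then S k \<inter> {1..n} else {1..n}))"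
    using assms by (intro prod.subset_diff) auto
  also have "(\<Prod>k\<in>{1..p} - Q. card (if k \<in> Q then S k \<inter> {1..n} else {1..n})) = (\<Prod>k\<in>{1..p} - Q. n)"
    by (intro prod.cong) auto
  also have "\<dots> = n ^ (p - card Q)"
    using fin assms by (simp add: card_Diff_subset)
  finally show ?thesis by simp
qed

definition tuples :: "nat \<Rightarrow> nat \<Rightarrow> (nat \<Rightarrow> nat) set" where
  "tuples p n = {1..p} \<rightarrow>\<^sub>E {1..n}"

definition tuples_meet :: "nat \<Rightarrow> (nat \<Rightarrow> nat) \<Rightarrow> (nat \<Rightarrow> nat) \<Rightarrow> bool" where
  "tuples_meet p t s \<longleftrightarrow> t ` {1..p} \<inter> s ` {1..p} \<noteq> {}"

lemma finite_tuples [simp]: "finite (tuples p n)"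
  by (simp add: tuples_def finite_PiE)

lemma finite_tuples_Collect: "finite {t \<in> {1..p} \<rightarrow>\<^sub>E {1..n :: nat}. Q (t :: nat \<Rightarrow> nat)}"
  by (rule finite_subset[of _ "{1..p} \<rightarrow>\<^sub>E {1..n}"]) (auto intro: finite_PiE)

lemma card_tuples: "card (tuples p n) = n ^ p"
  by (simp add: tuples_def card_PiE)

lemma card_tuple_range_le: "card (s ` {1..p}) \<le> p"
  using card_image_le[of "{1..p}" s] by simp

lemma card_Int_atLeastAtMost_le: "finite Z \<Longrightarrow> card (Z \<inter> {1..n}) \<le> card Z"
  by (intro card_mono) auto

text \<open>Union bound over a position of t whose entry occurs in s: p positions, at most p values
  there, and n^(p-1) choices for the other entries.\<close>

lemma card_meet_le: "card {t \<in> tuples p n. tuples_meet p t s} \<le> p ^ 2 * n ^ (p - 1)"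
proof -
  have "{t \<in> tuples p n. tuples_meet p t s} \<subseteq> (\<Union>a\<in>{1..p}. {t \<in> {1..p} \<rightarrow>\<^sub>E {1..n}. \<forall>a\<in>{a}. t a \<in> s ` {1..p}})"
    by (auto simp: tuples_def tuples_meet_def)
  then have "card {t \<in> tuples p n. tuples_meet p t s} \<le>
      card (\<Union>a\<in>{1..p}. {t \<in> {1..p} \<rightarrow>\<^sub>E {1..n}. \<forall>a\<in>{a}. t a \<in> s ` {1..p}})"
    by (intro card_mono finite_UN_I finite_tuples_Collect) auto
  also have "\<dots> \<le> (\<Sum>a\<in>{1..p}. card {t \<in> {1..p} \<rightarrow>\<^sub>E {1..n}. \<forall>a\<in>{a}. t a \<in> s ` {1..p}})"
    by (intro card_UN_le) simp
  also have "\<dots> \<le> (\<Sum>a\<in>{1..p}. p * n ^ (p - 1))"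
  proof (intro sum_mono)
    fix a assume "a \<in> {1..p}"
    then have "card {t \<in> {1..p} \<rightarrow>\<^sub>E {1..n}. \<forall>a\<in>{a}. t a \<in> s ` {1..p}} \<le>
        card (s ` {1..p} \<inter> {1..n}) * n ^ (p - 1)"
      using card_PiE_restricted_le[of "{a}" p n "\<lambda>_. s ` {1..p}"] by simp
    also have "\<dots> \<le> p * n ^ (p - 1)"
      using card_Int_atLeastAtMost_le[of "s ` {1..p}" n] card_tuple_range_le[of s p]
      by (intro mult_right_mono) auto
    finally show "card {t \<in> {1..p} \<rightarrow>\<^sub>E {1..n}. \<forall>a\<in>{a}. t a \<in> s ` {1..p}} \<le> p * n ^ (p - 1)" .
  qed
  finally show ?thesis by (simp add: power2_eq_square)
qed

text \<open>Some position \<open>a\<close> holds an index of s, and a second common index with Z,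
  different from t a, sits at another position \<open>b\<close>. For p = 1 the factor p - 1 makes
  the bound 0, so the truncated exponent p - 2 is harmless.\<close>

lemma card_meet_twice_le:
  assumes "finite Z" "s ` {1..p} \<subseteq> Z"
  shows "card {t \<in> tuples p n. tuples_meet p t s \<and> 2 \<le> card (t ` {1..p} \<inter> Z)}
    \<le> p * (p - 1) * (p * card Z * n ^ (p - 2))"
proof -
  let ?I = "SIGMA a:{1..p}. {1..p} - {a}"
  let ?S = "\<lambda>a k. if k = a then s ` {1..p} else Z"
  let ?X = "\<lambda>a b. {t \<in> {1..p} \<rightarrow>\<^sub>E {1..n}. \<forall>k\<in>{a, b}. t k \<in> ?S a k}"
  have "{t \<in> tuples p n. tuples_meet p t s \<and> 2 \<le> card (t ` {1..p} \<inter> Z)} \<subseteq> (\<Union>(a, b)\<in>?I. ?X a b)"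
  proof
    fix t assume t: "t \<in> {t \<in> tuples p n. tuples_meet p t s \<and> 2 \<le> card (t ` {1..p} \<inter> Z)}"
    then obtain a where a: "a \<in> {1..p}" "t a \<in> s ` {1..p}" unfolding tuples_meet_def by blast
    have "\<not> t ` {1..p} \<inter> Z \<subseteq> {t a}"
      using t card_mono[of "{t a}" "t ` {1..p} \<inter> Z"] by auto
    then obtain b where b: "b \<in> {1..p}" "t b \<in> Z" "t b \<noteq> t a" by blast
    then have "t \<in> ?X a b" using t a assms(2) by (auto simp: tuples_def)
    moreover have "(a, b) \<in> ?I" using a b by auto
    ultimately show "t \<in> (\<Union>(a, b)\<in>?I. ?X a b)" by blast
  qed
  then have "card {t \<in> tuples p n. tuples_meet p t s \<and> 2 \<le> card (t ` {1..p} \<inter> Z)} \<le>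
      card (\<Union>(a, b)\<in>?I. ?X a b)"
    by (intro card_mono) (auto simp: split_def simp del: One_nat_def intro!: finite_tuples_Collect)
  also have "\<dots> \<le> (\<Sum>(a, b)\<in>?I. card (?X a b))"
    using card_UN_le[of ?I "\<lambda>(a, b). ?X a b"] by (simp add: split_def)
  also have "\<dots> \<le> (\<Sum>(a, b)\<in>?I. p * card Z * n ^ (p - 2))"
  proof (intro sum_mono)
    fix z assume "z \<in> ?I"
    then obtain a b where z: "z = (a, b)" and ab: "a \<in> {1..p}" "b \<in> {1..p}" "b \<noteq> a" by blast
    then have "card (?X a b) \<le> (card (s ` {1..p} \<inter> {1..n}) * card (Z \<inter> {1..n})) * n ^ (p - 2)"
      using card_PiE_restricted_le[of "{a, b}" p n "?S a"] by (auto simp: numeral_2_eq_2)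
    also have "\<dots> \<le> (p * card Z) * n ^ (p - 2)"
      using card_Int_atLeastAtMost_le[of "s ` {1..p}" n] card_tuple_range_le[of s p]
        card_Int_atLeastAtMost_le[OF assms(1), of n]
      by (intro mult_right_mono mult_mono) auto
    finally show "(case z of (a, b) \<Rightarrow> card (?X a b)) \<le> (case z of (a, b) \<Rightarrow> p * card Z * n ^ (p - 2))"
      by (simp add: z)
  qed
  also have "\<dots> = card ?I * (p * card Z * n ^ (p - 2))" by (simp add: split_def)
  also have "card ?I = p * (p - 1)" by (subst card_SigmaI) auto
  finally show ?thesis .
qed

definition tuple_value ::
    "nat \<Rightarrow> ((nat \<times> nat \<Rightarrow> real) \<Rightarrow> real) \<Rightarrow> ('a \<Rightarrow> 'a \<Rightarrow> real) \<Rightarrow> (nat \<Rightarrow> nat) \<Rightarrow> (nat \<Rightarrow> 'a) \<Rightarrow> real" where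
  "tuple_value p \<phi> d i x = \<phi> (restrict (\<lambda>(a, b). d (x (i a)) (x (i b))) (index_pairs p))"

lemma index_pairs_mem: "(a, b) \<in> index_pairs p \<Longrightarrow> a \<in> {1..p} \<and> b \<in> {1..p}"
  by (auto simp: index_pairs_def)

text \<open>Phrased by distances so that it covers both points that agree at the indices in i and
  points moved by an isometry.\<close>

lemma tuple_value_cong:
  assumes "\<And>a b. a \<in> {1..p} \<Longrightarrow> b \<in> {1..p} \<Longrightarrow> d (x (i a)) (x (i b)) = d (y (i a)) (y (i b))"
  shows "tuple_value p \<phi> d i x = tuple_value p \<phi> d i y"
  unfolding tuple_value_def
  using assms by (intro arg_cong[where f = \<phi>] restrict_ext) (auto dest: index_pairs_mem)

text \<open>\<phi> is continuous only on extensional functions; composed with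
  \<open>restrict\<close> it becomes continuous on all functions.\<close>

lemma (in transitive_mm_space) measurable_tuple_value:
  assumes \<phi>: "continuous_map (distance_matrix_space p) euclideanreal \<phi>" and i: "i \<in> tuples p n"
  shows "tuple_value p \<phi> d i \<in> borel_measurable (PiM {1..n} (\<lambda>_. \<mu>))"
proof -
  let ?I = "index_pairs p"
  have "continuous_map euclidean (distance_matrix_space p) (\<lambda>y. restrict y ?I)"
    unfolding continuous_map_componentwise
    using continuous_on_product_coordinates
    by (auto simp: continuous_map_iff_continuous2 cong: continuous_on_cong)
  from continuous_map_compose[OF this \<phi>]
  have "(\<lambda>y. \<phi> (restrict y ?I)) \<in> borel_measurable borel"
    by (intro borel_measurable_continuous_onI) (simp add: o_def)
  \<comment> \<open>The default 0 makes every coordinate measurable; \<open>restrict\<close> then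
    discards it.\<close>
  moreover have "(\<lambda>x k. if k \<in> ?I then d (x (i (fst k))) (x (i (snd k))) else 0)
      \<in> borel_measurable (PiM {1..n} (\<lambda>_. \<mu>))"
  proof (rule measurable_coordinatewise_then_product)
    fix k
    show "(\<lambda>x. if k \<in> ?I then d (x (i (fst k))) (x (i (snd k))) else 0)
        \<in> borel_measurable (PiM {1..n} (\<lambda>_. \<mu>))"
    proof (cases "k \<in> ?I")
      case True
      then have "i (fst k) \<in> {1..n}" "i (snd k) \<in> {1..n}"
        using i by (cases k; auto simp: tuples_def dest!: index_pairs_mem)+
      then have "(\<lambda>x. (x (i (fst k)), x (i (snd k)))) \<in> measurable (PiM {1..n} (\<lambda>_. \<mu>)) (\<mu> \<Otimes>\<^sub>M \<mu>)"
        by (intro measurable_Pair measurable_component_singleton)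
      from measurable_compose[OF this measurable_distance] True show ?thesis by simp
    qed simp
  qed
  ultimately have "(\<lambda>x. \<phi> (restrict (\<lambda>k. if k \<in> ?I then d (x (i (fst k))) (x (i (snd k))) else 0) ?I))
      \<in> borel_measurable (PiM {1..n} (\<lambda>_. \<mu>))"
    by (rule measurable_compose[rotated])
  also have "(\<lambda>x. \<phi> (restrict (\<lambda>k. if k \<in> ?I then d (x (i (fst k))) (x (i (snd k))) else 0) ?I)) =
      tuple_value p \<phi> d i"
    unfolding tuple_value_def by (intro ext arg_cong[where f = \<phi>]) (auto simp: restrict_def)
  finally show ?thesis .
qed

lemma abs_tuple_value_le:
  assumes "\<And>y. y \<in> topspace (distance_matrix_space p) \<Longrightarrow> \<bar>\<phi> y\<bar> \<le> A"
  shows "\<bar>tuple_value p \<phi> d i x\<bar> \<le> A"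
  unfolding tuple_value_def by (rule assms) simp

text \<open>The sample points are the coordinates of a product space here, which is what Fubini's
  theorem needs in \<open>integral_mult_invariant\<close>.\<close>

lemma (in transitive_mm_space) abs_cumulant_distance_sum_le:
  fixes A :: real
  assumes \<phi>: "continuous_map (distance_matrix_space p) euclideanreal \<phi>"
    and A: "\<And>y. y \<in> topspace (distance_matrix_space p) \<Longrightarrow> \<bar>\<phi> y\<bar> \<le> A"
    and p: "p \<ge> 1" and n: "n \<ge> 1" and r: "r \<ge> 2"
  shows "\<bar>cumulant (PiM {1..n} (\<lambda>_. \<mu>)) (distance_sum p \<phi> d n) r\<bar>
    \<le> (A * real p ^ 2) ^ r * real (2 * r) ^ (r - 1) * real n ^ ((p - 1) * r)"
proof -
  let ?\<Omega> = "PiM {1..n} (\<lambda>_. \<mu>)"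
  interpret \<Omega>: prob_space ?\<Omega> by (rule prob_space_PiM) (rule prob)
  define T where "T = tuples p n"
  define Y where "Y = tuple_value p \<phi> d"
  \<comment> \<open>Labels of the r arguments of a joint cumulant, with 0 as the root. Labels are
    kept apart from tuples because one tuple may occur several times.\<close>
  define L where "L = {..<r}"
  define W where "W = {1..<r}"
  define m where "m = (\<lambda>\<sigma> (B :: nat set). \<integral>x. (\<Prod>b\<in>B. Y (\<sigma> b) x) \<partial>?\<Omega>)"
  have LW: "L = insert 0 W" "0 \<notin> W" "finite W" "card W = r - 1" "W \<noteq> {}" "finite L"
    using r by (auto simp: L_def W_def)
  have finT: "finite T" by (simp add: T_def)
  have A0: "A \<ge> 0"
    using A[of "restrict (\<lambda>_. 0) (index_pairs p)"] by (auto simp: topspace_product_topology)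
  have Y_bdd: "\<bar>Y i x\<bar> \<le> A" for i x
    unfolding Y_def by (rule abs_tuple_value_le) (rule A)
  have Y_meas: "Y i \<in> borel_measurable ?\<Omega>" if "i \<in> T" for i
    using that \<phi> unfolding Y_def T_def by (intro measurable_tuple_value)
  have prod_bdd: "\<bar>\<Prod>b\<in>B. Y (\<sigma> b) x\<bar> \<le> A ^ card B" for \<sigma> B x
    unfolding abs_prod using prod_mono[of B "\<lambda>b. \<bar>Y (\<sigma> b) x\<bar>" "\<lambda>_. A"] Y_bdd by auto
  have prod_meas: "(\<lambda>x. \<Prod>b\<in>B. Y (\<sigma> b) x) \<in> borel_measurable ?\<Omega>" if "\<And>b. b \<in> B \<Longrightarrow> \<sigma> b \<in> T" for \<sigma> B
    using that Y_meas by (intro borel_measurable_prod) auto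
  have prod_int: "integrable ?\<Omega> (\<lambda>x. \<Prod>b\<in>B. Y (\<sigma> b) x)" if "\<And>b. b \<in> B \<Longrightarrow> \<sigma> b \<in> T" for \<sigma> B
    using prod_bdd prod_meas[OF that] by (intro \<Omega>.integrable_const_bound[where B = "A ^ card B"]) auto
  have m_empty: "m \<sigma> {} = 1" for \<sigma> using \<Omega>.prob_space by (simp add: m_def)
  have S: "distance_sum p \<phi> d n x = (\<Sum>i\<in>T. Y i x)" for x
    by (simp add: distance_sum_def T_def tuples_def Y_def tuple_value_def)

  have cumulant_eq: "cumulant ?\<Omega> (distance_sum p \<phi> d n) r =
      (\<Sum>\<sigma>\<in>L \<rightarrow>\<^sub>E T. set_cumulant (m \<sigma>) {0} W)"
  proof -
    have "cumulant ?\<Omega> (distance_sum p \<phi> d n) (Suc (card W)) = (\<Sum>\<sigma>\<in>insert 0 W \<rightarrow>\<^sub>E T. set_cumulant (m \<sigma>) {0} W)"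
    proof (subst sum_set_cumulant[where \<mu> = "\<lambda>k. \<integral>x. distance_sum p \<phi> d n x ^ k \<partial>?\<Omega>"])
      show "cumulant ?\<Omega> (distance_sum p \<phi> d n) (Suc (card W)) = fact (card W) *
        fps_nth (fps_deriv (Abs_fps (\<lambda>k. (\<integral>x. distance_sum p \<phi> d n x ^ k \<partial>?\<Omega>) / fact k)) *
          inverse (Abs_fps (\<lambda>k. (\<integral>x. distance_sum p \<phi> d n x ^ k \<partial>?\<Omega>) / fact k))) (card W)"
      proof (rule cumulant_eq_fps)
        show "prob_space ?\<Omega>" by (rule \<Omega>.prob_space_axioms)
        show "distance_sum p \<phi> d n \<in> borel_measurable ?\<Omega>"
          unfolding S[abs_def] using Y_meas by (intro borel_measurable_sum) auto
        show "\<bar>distance_sum p \<phi> d n x\<bar> \<le> card T * A" for x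
          unfolding S using sum_bounded_above[of T "\<lambda>i. \<bar>Y i x\<bar>" A] Y_bdd
          by (intro order_trans[OF sum_abs]) auto
      qed
      fix B :: "nat set" assume B: "finite B"
      show "(\<Sum>\<sigma>\<in>B \<rightarrow>\<^sub>E T. m \<sigma> B) = (\<integral>x. distance_sum p \<phi> d n x ^ card B \<partial>?\<Omega>)"
      proof -
        have "(\<Sum>\<sigma>\<in>B \<rightarrow>\<^sub>E T. m \<sigma> B) = (\<integral>x. (\<Sum>\<sigma>\<in>B \<rightarrow>\<^sub>E T. \<Prod>b\<in>B. Y (\<sigma> b) x) \<partial>?\<Omega>)"
          unfolding m_def by (intro Bochner_Integration.integral_sum[symmetric] prod_int) auto
        also have "(\<lambda>x. \<Sum>\<sigma>\<in>B \<rightarrow>\<^sub>E T. \<Prod>b\<in>B. Y (\<sigma> b) x) = (\<lambda>x. distance_sum p \<phi> d n x ^ card B)"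
          using prod_sum_PiE[of B "\<lambda>_. T" "\<lambda>_ i. Y i x" for x] B finT by (simp add: S)
        finally show ?thesis .
      qed
      show "m \<sigma> B = m \<tau> B" if "\<And>b. b \<in> B \<Longrightarrow> \<sigma> b = \<tau> b" for \<sigma> \<tau>
        using that by (simp add: m_def)
    qed (use LW m_empty in auto)
    then show ?thesis using LW r by simp
  qed

  let ?ix = "\<lambda>\<sigma> B. \<Union>b\<in>B. \<sigma> b ` {1..p}"
  have prod_dep: "(\<Prod>b\<in>B. Y (\<sigma> b) x) = (\<Prod>b\<in>B. Y (\<sigma> b) y)"
    if "\<And>k. k \<in> ?ix \<sigma> B \<Longrightarrow> x k = y k" for \<sigma> B x y
    unfolding Y_def
  proof (intro prod.cong refl tuple_value_cong)
    fix b a a' assume "b \<in> B" "a \<in> {1..p}" "a' \<in> {1..p}"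
    then have "x (\<sigma> b a) = y (\<sigma> b a)" "x (\<sigma> b a') = y (\<sigma> b a')"
      by (blast intro: that)+
    then show "d (x (\<sigma> b a)) (x (\<sigma> b a')) = d (y (\<sigma> b a)) (y (\<sigma> b a'))" by simp
  qed
  have m_mult: "m \<sigma> (B \<union> C) = m \<sigma> B * m \<sigma> C"
    if \<sigma>: "\<sigma> \<in> L \<rightarrow> T" and BC: "B \<subseteq> L" "C \<subseteq> L" "B \<inter> C = {}" and meet: "card (?ix \<sigma> B \<inter> ?ix \<sigma> C) \<le> 1"
    for \<sigma> B C
  proof -
    have fin: "finite B" "finite C" using BC LW by (auto intro: finite_subset)
    have ix: "?ix \<sigma> B' \<subseteq> {1..n}" if "B' \<subseteq> L" for B'
    proof -
      have "\<sigma> b a \<in> {1..n}" if "b \<in> B'" "a \<in> {1..p}" for a b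
        using \<sigma> that \<open>B' \<subseteq> L\<close> PiE_mem[of "\<sigma> b" "{1..p}" "\<lambda>_. {1..n}" a]
        by (auto simp: T_def tuples_def Pi_def)
      then show ?thesis by blast
    qed
    \<comment> \<open>Without a common index any coordinate serves as j, and n >= 1 provides
      one.\<close>
    have "\<exists>j\<in>{1..n}. ?ix \<sigma> B \<inter> ?ix \<sigma> C \<subseteq> {j}"
    proof (cases "?ix \<sigma> B \<inter> ?ix \<sigma> C = {}")
      case True
      then show ?thesis using n by (intro bexI[of _ 1]) auto
    next
      case False
      then obtain j where j: "j \<in> ?ix \<sigma> B \<inter> ?ix \<sigma> C" by blast
      have "finite (?ix \<sigma> B \<inter> ?ix \<sigma> C)" using fin by auto
      then have "\<forall>k\<in>?ix \<sigma> B \<inter> ?ix \<sigma> C. \<forall>l\<in>?ix \<sigma> B \<inter> ?ix \<sigma> C. k = l"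
        using meet unfolding One_nat_def by (rule card_le_Suc0_iff_eq[THEN iffD1])
      then have "?ix \<sigma> B \<inter> ?ix \<sigma> C \<subseteq> {j}" using j by blast
      then show ?thesis using j ix[OF BC(1)] by blast
    qed
    then obtain j where j: "j \<in> {1..n}" "?ix \<sigma> B \<inter> ?ix \<sigma> C \<subseteq> {j}" by blast
    have "m \<sigma> (B \<union> C) = (\<integral>x. (\<Prod>b\<in>B. Y (\<sigma> b) x) * (\<Prod>b\<in>C. Y (\<sigma> b) x) \<partial>?\<Omega>)"
      using fin BC by (simp add: m_def prod.union_disjoint)
    also have "\<dots> = m \<sigma> B * m \<sigma> C"
      unfolding m_def
    proof (rule integral_mult_invariant[where j = j and U = "?ix \<sigma> B" and V = "?ix \<sigma> C"
          and C = "A ^ card B" and C' = "A ^ card C"])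
      show "?ix \<sigma> B \<subseteq> {1..n}" "?ix \<sigma> C \<subseteq> {1..n}" by (fact ix[OF BC(1)], fact ix[OF BC(2)])
      show "(\<lambda>x. \<Prod>b\<in>B. Y (\<sigma> b) x) \<in> borel_measurable ?\<Omega>" "(\<lambda>x. \<Prod>b\<in>C. Y (\<sigma> b) x) \<in> borel_measurable ?\<Omega>"
        by (rule prod_meas, use \<sigma> BC in blast)+
      show "(\<Prod>b\<in>B. Y (\<sigma> b) x) = (\<Prod>b\<in>B. Y (\<sigma> b) y)" if "\<And>k. k \<in> ?ix \<sigma> B \<Longrightarrow> x k = y k" for x y
        using that by (rule prod_dep)
      show "(\<Prod>b\<in>C. Y (\<sigma> b) x) = (\<Prod>b\<in>C. Y (\<sigma> b) y)" if "\<And>k. k \<in> ?ix \<sigma> C \<Longrightarrow> x k = y k" for x y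
        using that by (rule prod_dep)
      show "(\<Prod>b\<in>B. Y (\<sigma> b) (g \<circ> x)) = (\<Prod>b\<in>B. Y (\<sigma> b) x)"
        if g: "\<forall>u\<in>M. \<forall>v\<in>M. d (g u) (g v) = d u v" and x: "\<And>k. k \<in> {1..n} \<Longrightarrow> x k \<in> M" for g x
        unfolding Y_def
      proof (intro prod.cong refl tuple_value_cong)
        fix b a a' assume b: "b \<in> B" and a: "a \<in> {1..p}" "a' \<in> {1..p}"
        then have "\<sigma> b a \<in> {1..n}" "\<sigma> b a' \<in> {1..n}" using ix[OF BC(1)] by blast+
        then show "d ((g \<circ> x) (\<sigma> b a)) ((g \<circ> x) (\<sigma> b a')) = d (x (\<sigma> b a)) (x (\<sigma> b a'))"
          using g x by simp
      qed
    qed (use j prod_bdd in auto)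
    finally show ?thesis .
  qed

  define N where "N = (\<lambda>(\<sigma> :: nat \<Rightarrow> nat \<Rightarrow> nat) a. 2 \<le> card (\<sigma> a ` {1..p} \<inter> ?ix \<sigma> (L - {a})))"
  let ?good = "\<lambda>\<sigma>. of_bool (\<forall>a\<in>L. N \<sigma> a) :: real"
  let ?fw = "\<lambda>\<sigma>. forest_weight (\<lambda>x y. tuples_meet p (\<sigma> x) (\<sigma> y))"
  have vanish: "set_cumulant (m \<sigma>) {0} W = 0" if \<sigma>: "\<sigma> \<in> L \<rightarrow> T" and a: "a \<in> L" "\<not> N \<sigma> a" for \<sigma> a
  proof -
    have mult: "m \<sigma> (insert a B) = m \<sigma> {a} * m \<sigma> B" if B: "B \<subseteq> L - {a}" for B
    proof -
      have "?ix \<sigma> {a} \<inter> ?ix \<sigma> B \<subseteq> \<sigma> a ` {1..p} \<inter> ?ix \<sigma> (L - {a})" using B by auto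
      then have "card (?ix \<sigma> {a} \<inter> ?ix \<sigma> B) \<le> card (\<sigma> a ` {1..p} \<inter> ?ix \<sigma> (L - {a}))"
        by (intro card_mono) auto
      also have "\<dots> \<le> 1" using a by (simp add: N_def)
      finally have "m \<sigma> ({a} \<union> B) = m \<sigma> {a} * m \<sigma> B"
        using \<sigma> a B by (intro m_mult) auto
      then show ?thesis by simp
    qed
    show ?thesis
    \<comment> \<open>The uncorrelated label is either the root or an argument, which calls for
      different vanishing lemmas.\<close>
    proof (cases "a = 0")
      case True
      show ?thesis
      proof (rule set_cumulant_eq_0)
        show "m \<sigma> ({0} \<union> B) = m \<sigma> {0} * m \<sigma> B" if "B \<subseteq> W" for B
          using mult[of B] that True LW(1,2) by auto
      qed (fact LW m_empty)+
    next
      case False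
      show ?thesis
      proof (rule set_cumulant_eq_0'[where w = a])
        show "m \<sigma> (insert a B) = m \<sigma> {a} * m \<sigma> B" if "B \<subseteq> {0} \<union> W - {a}" for B
          using that LW(1) by (intro mult) auto
      qed (use False a LW m_empty in auto)
    qed
  qed
  define c where "c = A ^ r * 2 ^ (r - 1)"
  have c0: "c \<ge> 0" using A0 by (simp add: c_def)
  have cumulant_le: "\<bar>set_cumulant (m \<sigma>) {0} W\<bar> \<le> c * (?good \<sigma> * ?fw \<sigma> {0} W)" if \<sigma>: "\<sigma> \<in> L \<rightarrow> T" for \<sigma>
  proof (cases "\<forall>a\<in>L. N \<sigma> a")
    case True
    have "\<bar>set_cumulant (m \<sigma>) {0} W\<bar> \<le> A ^ (card {0::nat} + card W) * 2 ^ card W * ?fw \<sigma> {0} W"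
    proof (rule abs_set_cumulant_le[where V = L])
      show "\<bar>m \<sigma> B\<bar> \<le> A ^ card B" if B: "B \<subseteq> L" for B
      proof -
        have "\<bar>m \<sigma> B\<bar> \<le> (\<integral>x. \<bar>\<Prod>b\<in>B. Y (\<sigma> b) x\<bar> \<partial>?\<Omega>)"
          unfolding m_def by (rule integral_abs_bound)
        also have "\<dots> \<le> A ^ card B"
          using \<sigma> B by (intro \<Omega>.integral_le_const integrable_abs prod_int AE_I2 prod_bdd) auto
        finally show ?thesis .
      qed
      show "m \<sigma> (B \<union> C) = m \<sigma> B * m \<sigma> C" if "B \<subseteq> L" "C \<subseteq> L" "B \<inter> C = {}"
        "\<forall>b\<in>B. \<forall>c\<in>C. \<not> tuples_meet p (\<sigma> c) (\<sigma> b)" for B C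
      proof (rule m_mult[OF \<sigma> that(1-3)])
        have "?ix \<sigma> B \<inter> ?ix \<sigma> C = {}" using that(4) by (fastforce simp: tuples_meet_def)
        then show "card (?ix \<sigma> B \<inter> ?ix \<sigma> C) \<le> 1" by simp
      qed
    qed (use LW A0 m_empty in auto)
    then show ?thesis using True LW r by (simp add: c_def)
  next
    case False
    then show ?thesis using vanish[OF \<sigma>] by auto
  qed

  define D where "D = real (p ^ 2 * n ^ (p - 1))"
  \<comment> \<open>Bound of \<open>card_meet_twice_le\<close> with Z the indices of all other
    tuples. There are at most (r - 1) p of them, enlarged to r p so that r joins the power of r from
    the tree count.\<close>
  define E where "E = real (p * (p - 1) * (p * (r * p) * n ^ (p - 2)))"
  have forest_sum: "(\<Sum>\<sigma>\<in>L \<rightarrow>\<^sub>E T. ?good \<sigma> * ?fw \<sigma> {0} W) \<le> real n ^ p * (real r ^ (r - 2) * D ^ (r - 2) * E)"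
  proof -
    have inner: "(\<Sum>\<tau>\<in>W \<rightarrow>\<^sub>E T. ?good (override_on \<sigma> \<tau> W) * ?fw (override_on \<sigma> \<tau> W) {0} W)
        \<le> real r ^ (r - 2) * D ^ (r - 2) * E" if \<sigma>: "\<sigma> \<in> L \<rightarrow> T" for \<sigma>
    proof -
      have "(\<Sum>\<tau>\<in>W \<rightarrow>\<^sub>E T. ?good (override_on \<sigma> \<tau> W) * ?fw (override_on \<sigma> \<tau> W) {0} W)
        \<le> card {0::nat} * (real (card {0::nat}) + card W) ^ (card W - 1) * D ^ (card W - 1) * E"
      proof (rule sum_forest_weight_le)
        show "(\<Sum>t\<in>T. of_bool (tuples_meet p t s)) \<le> D" for s
          using card_meet_le[of p n s] finT
          by (simp add: D_def T_def Int_def flip: of_nat_power of_nat_mult)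
        fix \<sigma> a b assume *: "\<sigma> \<in> L \<rightarrow> T" "a \<in> L" "b \<in> L" "a \<noteq> b"
        let ?Z = "?ix \<sigma> (L - {a})"
        \<comment> \<open>\<open>?Z\<close> leaves out the label a, so it does not move with
          t.\<close>
        have "?ix (\<sigma>(a := t)) (L - {a}) = ?Z" for t by (intro SUP_cong) auto
        then have "(\<Sum>t\<in>T. of_bool (tuples_meet p t (\<sigma> b) \<and> N (\<sigma>(a := t)) a)) =
            (\<Sum>t\<in>T. of_bool (tuples_meet p t (\<sigma> b) \<and> 2 \<le> card (t ` {1..p} \<inter> ?Z)) :: real)"
          by (simp add: N_def)
        also have "\<dots> = real (card {t \<in> T. tuples_meet p t (\<sigma> b) \<and> 2 \<le> card (t ` {1..p} \<inter> ?Z)})"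
          using finT by (simp add: Int_def)
        also have "\<dots> \<le> real (p * (p - 1) * (p * card ?Z * n ^ (p - 2)))"
          unfolding T_def of_nat_le_iff using * LW by (intro card_meet_twice_le) auto
        also have "\<dots> \<le> E"
        proof -
          have "card ?Z \<le> (\<Sum>b\<in>L - {a}. card (\<sigma> b ` {1..p}))"
            using LW by (intro card_UN_le) auto
          also have "\<dots> \<le> card (L - {a}) * p"
            using sum_bounded_above[of "L - {a}" "\<lambda>b. card (\<sigma> b ` {1..p})" p, OF card_tuple_range_le] by simp
          also have "\<dots> \<le> r * p"
            using card_mono[of L "L - {a}"] LW(6) by (intro mult_right_mono) (auto simp: L_def)
          finally show ?thesis
            unfolding E_def of_nat_le_iff by (intro mult_le_mono order_refl)
        qed
        finally show "(\<Sum>t\<in>T. of_bool (tuples_meet p t (\<sigma> b) \<and> N (\<sigma>(a := t)) a)) \<le> E" .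
      qed (use LW \<sigma> finT in \<open>auto simp: D_def E_def\<close>)
      \<comment> \<open>One root and r - 1 further vertices: Cayley's number r^(r-2).\<close>
      also have "\<dots> = real r ^ (r - 2) * D ^ (r - 2) * E"
      proof -
        have "real (card {0::nat}) + card W = real r" "card W - 1 = r - 2" using LW r by auto
        then show ?thesis by simp
      qed
      finally show ?thesis .
    qed
    have "(\<Sum>\<sigma>\<in>L \<rightarrow>\<^sub>E T. ?good \<sigma> * ?fw \<sigma> {0} W) =
        (\<Sum>\<sigma>\<in>{0} \<rightarrow>\<^sub>E T. \<Sum>\<tau>\<in>W \<rightarrow>\<^sub>E T. ?good (override_on \<sigma> \<tau> W) * ?fw (override_on \<sigma> \<tau> W) {0} W)"
      using sum_PiE_Un[of "{0}" W "\<lambda>\<sigma>. ?good \<sigma> * ?fw \<sigma> {0} W" T] LW by simp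
    also have "\<dots> \<le> (\<Sum>\<sigma>\<in>{0::nat} \<rightarrow>\<^sub>E T. real r ^ (r - 2) * D ^ (r - 2) * E)"
    proof (rule sum_mono)
      fix \<sigma> assume \<sigma>: "\<sigma> \<in> {0::nat} \<rightarrow>\<^sub>E T"
      \<comment> \<open>\<sigma> is \<open>undefined\<close> off 0, whereas \<open>inner\<close>
        wants values in T on all of L. The constant extension agrees with it on L once W is
        overridden.\<close>
      let ?\<sigma> = "\<lambda>_::nat. \<sigma> 0"
      have ov: "?good (override_on \<sigma> \<tau> W) * ?fw (override_on \<sigma> \<tau> W) {0} W =
          ?good (override_on ?\<sigma> \<tau> W) * ?fw (override_on ?\<sigma> \<tau> W) {0} W" for \<tau>
      proof -
        have eq: "override_on \<sigma> \<tau> W a = override_on ?\<sigma> \<tau> W a" if "a \<in> L" for a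
          using that LW by (auto simp: override_on_def)
        have "N (override_on \<sigma> \<tau> W) a = N (override_on ?\<sigma> \<tau> W) a" if "a \<in> L" for a
          unfolding N_def using that eq
          by (intro arg_cong[where f = "\<lambda>X. 2 \<le> card X"] arg_cong2[where f = "(\<inter>)"] SUP_cong) auto
        moreover have "?fw (override_on \<sigma> \<tau> W) {0} W = ?fw (override_on ?\<sigma> \<tau> W) {0} W"
          using eq LW by (intro forest_weight_cong) auto
        ultimately show ?thesis by simp
      qed
      show "(\<Sum>\<tau>\<in>W \<rightarrow>\<^sub>E T. ?good (override_on \<sigma> \<tau> W) * ?fw (override_on \<sigma> \<tau> W) {0} W)
          \<le> real r ^ (r - 2) * D ^ (r - 2) * E"
        unfolding ov using \<sigma> by (intro inner) auto
    qed
    also have "\<dots> = real n ^ p * (real r ^ (r - 2) * D ^ (r - 2) * E)"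
      by (simp add: card_PiE T_def card_tuples)
    finally show ?thesis .
  qed

  \<comment> \<open>Needed because n^p E = n^(p-1) (n E). For p = 1 truncated subtraction breaks n *
    n^(p-2) = n^(p-1), but then E = 0.\<close>
  have nE: "real n * E \<le> real r * real p ^ 2 * D"
  proof (cases "p = 1")
    case False
    then have "n * n ^ (p - 2) = n ^ (p - 1)" using p by (cases p) (auto simp flip: power_Suc)
    then have "n * (p * (p - 1) * (p * (r * p) * n ^ (p - 2))) = p * (p - 1) * (p * (r * p) * n ^ (p - 1))"
      by (metis mult.assoc mult.left_commute)
    also have "\<dots> \<le> p * p * (p * (r * p) * n ^ (p - 1))"
      by (intro mult_right_mono mult_left_mono) auto
    also have "\<dots> = r * p ^ 2 * (p ^ 2 * n ^ (p - 1))" by (simp add: power2_eq_square)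
    finally show ?thesis
      unfolding D_def E_def of_nat_mult[symmetric] of_nat_power[symmetric] of_nat_le_iff .
  qed (simp add: E_def D_def)
  have "\<bar>cumulant ?\<Omega> (distance_sum p \<phi> d n) r\<bar> \<le> (\<Sum>\<sigma>\<in>L \<rightarrow>\<^sub>E T. \<bar>set_cumulant (m \<sigma>) {0} W\<bar>)"
    unfolding cumulant_eq by (rule sum_abs)
  also have "\<dots> \<le> (\<Sum>\<sigma>\<in>L \<rightarrow>\<^sub>E T. c * (?good \<sigma> * ?fw \<sigma> {0} W))"
    by (intro sum_mono cumulant_le) auto
  also have "\<dots> \<le> c * (real n ^ p * (real r ^ (r - 2) * D ^ (r - 2) * E))"
    unfolding sum_distrib_left[symmetric] using c0 by (intro mult_left_mono forest_sum)
  also have "\<dots> = c * real n ^ (p - 1) * real r ^ (r - 2) * D ^ (r - 2) * (real n * E)"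
    using p by (cases p) auto
  also have "\<dots> \<le> c * real n ^ (p - 1) * real r ^ (r - 2) * D ^ (r - 2) * (real r * real p ^ 2 * D)"
    using c0 by (intro mult_left_mono nE) (auto simp: D_def)
  \<comment> \<open>The r - 1 factors D together with the extra p^2 and n^(p-1) supply r copies of
    each; the powers of 2 and r combine to (2r)^(r-1).\<close>
  also have "\<dots> = (A * real p ^ 2) ^ r * real (2 * r) ^ (r - 1) * real n ^ ((p - 1) * r)"
  proof -
    obtain q where q: "r = Suc (Suc q)" using r by (metis Suc_diff_Suc add_2_eq_Suc le_add_diff_inverse)
    have D: "D = real p ^ 2 * real n ^ (p - 1)" by (simp add: D_def)
    show ?thesis
      unfolding c_def D power_mult of_nat_mult power_mult_distrib
      by (simp add: q mult_ac)
  qed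
  finally show ?thesis .
qed

theorem theorem5p6:
  fixes M :: "'a set" and d :: "'a \<Rightarrow> 'a \<Rightarrow> real" and \<mu> :: "'a measure"
    and P :: "'w measure" and X :: "nat \<Rightarrow> 'w \<Rightarrow> 'a"
    and p n r :: nat and \<phi> :: "(nat \<times> nat \<Rightarrow> real) \<Rightarrow> real"
  assumes homogeneous: "compact_homogeneous_space TYPE('g) M d \<mu>"
    and prob: "prob_space P"
    and indep: "prob_space.indep_vars P (\<lambda>_. \<mu>) X {1..}"
    and law: "\<And>i. i \<ge> 1 \<Longrightarrow> distr P \<mu> (X i) = \<mu>"
    and p: "p \<ge> 1"
    and phi: "continuous_map (distance_matrix_space p) euclideanreal \<phi>"
    and n: "n \<ge> 1"
    and r: "r \<ge> 2"
  defines "A \<equiv> sup_norm_on (topspace (distance_matrix_space p)) \<phi>"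
  shows "ennreal \<bar>cumulant P (\<lambda>\<omega>. distance_sum p \<phi> d n (\<lambda>i. X i \<omega>)) r\<bar>
         \<le> (A * of_nat p ^ 2) ^ r * of_nat (2 * r) ^ (r - 1) * of_nat n ^ ((p - 1) * r)"
proof (cases "A = \<top>")
  case True
  have "(A * of_nat p ^ 2) ^ r * of_nat (2 * r) ^ (r - 1) * of_nat n ^ ((p - 1) * r) = \<top>"
    using p n r True by (simp add: ennreal_top_mult ennreal_mult_top power_eq_top_ennreal ennreal_mult_eq_top_iff)
  then show ?thesis by simp
next
  case False
  interpret P: prob_space P by fact
  interpret transitive_mm_space M d \<mu> using homogeneous by (rule compact_homogeneous_imp_transitive)
  let ?\<Omega> = "PiM {1..n} (\<lambda>_. \<mu>)"
  let ?S = "distance_sum p \<phi> d n"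
  define a where "a = enn2real A"
  have Aa: "A = ennreal a" using False by (simp add: a_def less_top)
  have a0: "a \<ge> 0" by (simp add: a_def)
  have "\<bar>\<phi> y\<bar> \<le> a" if "y \<in> topspace (distance_matrix_space p)" for y
  proof -
    have "ennreal \<bar>\<phi> y\<bar> \<le> A" unfolding A_def sup_norm_on_def using that by (rule SUP_upper)
    then show ?thesis using a0 by (simp add: Aa)
  qed
  note bound = abs_cumulant_distance_sum_le[OF phi this p n r]
  have X: "X i \<in> measurable P \<mu>" if "i \<ge> 1" for i
    using indep that by (auto simp: P.indep_vars_def)
  have indep': "P.indep_vars (\<lambda>_. \<mu>) X {1..n}"
    using indep by (rule P.indep_vars_subset) auto
  define X' where "X' = (\<lambda>\<omega>. \<lambda>i\<in>{1..n}. X i \<omega>)"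
  have X': "X' \<in> measurable P ?\<Omega>"
    unfolding X'_def using X by (intro measurable_restrict) auto
  have distr: "distr P ?\<Omega> X' = ?\<Omega>"
  proof -
    have "distr P ?\<Omega> X' = PiM {1..n} (\<lambda>i. distr P \<mu> (X i))"
      unfolding X'_def using indep' X n by (subst (asm) P.indep_vars_iff_distr_eq_PiM') auto
    also have "\<dots> = ?\<Omega>" using law by (intro PiM_cong) auto
    finally show ?thesis .
  qed
  have S_eq: "?S (\<lambda>i. X i \<omega>) = ?S (X' \<omega>)" for \<omega>
  proof -
    have "tuple_value p \<phi> d i (\<lambda>i. X i \<omega>) = tuple_value p \<phi> d i (X' \<omega>)" if "i \<in> tuples p n" for i
      using that by (intro tuple_value_cong) (auto simp: X'_def tuples_def PiE_iff)
    then show ?thesis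
      by (simp add: distance_sum_def tuple_value_def tuples_def)
  qed
  have S_meas: "?S \<in> borel_measurable ?\<Omega>"
  proof -
    have "?S = (\<lambda>x. \<Sum>i\<in>tuples p n. tuple_value p \<phi> d i x)"
      by (simp add: fun_eq_iff distance_sum_def tuple_value_def tuples_def)
    then show ?thesis using measurable_tuple_value[OF phi] by simp
  qed
  \<comment> \<open>The cumulant sees its variable only through the moment generating function, so
    equality of these functions moves the bound from the product space to P.\<close>
  have "(\<integral>\<omega>. exp (t * ?S (\<lambda>i. X i \<omega>)) \<partial>P) = (\<integral>x. exp (t * ?S x) \<partial>?\<Omega>)" for t
  proof -
    have "(\<integral>x. exp (t * ?S x) \<partial>distr P ?\<Omega> X') = (\<integral>\<omega>. exp (t * ?S (X' \<omega>)) \<partial>P)"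
      using S_meas by (intro integral_distr X') auto
    then show ?thesis unfolding distr S_eq by simp
  qed
  then have "cumulant P (\<lambda>\<omega>. ?S (\<lambda>i. X i \<omega>)) r = cumulant ?\<Omega> ?S r"
    by (simp add: cumulant_def)
  then have "ennreal \<bar>cumulant P (\<lambda>\<omega>. ?S (\<lambda>i. X i \<omega>)) r\<bar> \<le>
      ennreal ((a * real p ^ 2) ^ r * real (2 * r) ^ (r - 1) * real n ^ ((p - 1) * r))"
    using bound by (simp add: ennreal_leI)
  also have "\<dots> = (A * of_nat p ^ 2) ^ r * of_nat (2 * r) ^ (r - 1) * of_nat n ^ ((p - 1) * r)"
    using a0 by (simp only: Aa ennreal_mult ennreal_power[symmetric] ennreal_of_nat_eq_real_of_nat
        zero_le_power mult_nonneg_nonneg of_nat_0_le_iff)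
  finally show ?thesis .
qed

end
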